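(* Let $p$ be a prime and let $\Gamma$ be a (finite) cyclic $p$-group. Then every coflasque $\mathbb{Z}\Gamma$-module is permutation projective.
   Context: All modules are left modules and are not assumed finitely generated. A $\mathbb{Z}\Gamma$-module is a permutation module if it has a basis as a $\mathbb{Z}$-module which is permuted by the action of $\Gamma$. A $\mathbb{Z}\Gamma$-module is permutation projective if it is isomorphic to a direct summand (as a $\mathbb{Z}\Gamma$-module) of some permutation module. A $\mathbb{Z}\Gamma$-module $M$ is coflasque if $M$ is free as a $\mathbb{Z}$-module and the group cohomology $H^1(\Gamma',M)$ vanishes for all subgroups $\Gamma'$ of $\Gamma$. *)

theory Defs
  imports
    Complex_Main
    "HOL-Library.Poly_Mapping"
    "HOL-Library.FuncSet"
    "HOL-Computational_Algebra.Group_Closure"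
    "HOL-Computational_Algebra.Primes"
begin

text \<open>
  Conventions.  The group \<open>\<Gamma>\<close> is an abelian group written additively, given by a type
  \<^typ>\<open>'g::ab_group_add\<close>.  Its integral group ring is the type \<^typ>\<open>'g \<Rightarrow>\<^sub>0 int\<close> of finitely supported
  functions, with the convolution product of \<^theory>\<open>HOL-Library.Poly_Mapping\<close>; the basis element
  of \<open>g\<close> is \<^term>\<open>Poly_Mapping.single g (1::int)\<close>.  Since \<open>\<Gamma>\<close> is abelian this ring is commutative, and
  a module over it is a scalar multiplication satisfying the predicate \<^locale>\<open>module\<close> of the library.
\<close>

definition act :: "(('g::ab_group_add \<Rightarrow>\<^sub>0 int) \<Rightarrow> 'm::ab_group_add \<Rightarrow> 'm) \<Rightarrow> 'g \<Rightarrow> 'm \<Rightarrow> 'm"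
  where "act s g x = s (Poly_Mapping.single g 1) x"

text \<open>The underlying \<open>\<int>\<close>-module: restriction of scalars along \<^term>\<open>of_int\<close>, from \<open>\<int>\<close> to \<open>\<int>\<Gamma>\<close>.\<close>

definition int_scale :: "(('g::ab_group_add \<Rightarrow>\<^sub>0 int) \<Rightarrow> 'm::ab_group_add \<Rightarrow> 'm) \<Rightarrow> int \<Rightarrow> 'm \<Rightarrow> 'm"
  where "int_scale s n x = s (of_int n) x"

definition int_basis :: "(('g::ab_group_add \<Rightarrow>\<^sub>0 int) \<Rightarrow> 'm::ab_group_add \<Rightarrow> 'm) \<Rightarrow> 'm set \<Rightarrow> bool"
  where "int_basis s B \<longleftrightarrow>
    \<not> module.dependent (int_scale s) B \<and> module.span (int_scale s) B = UNIV"

definition permutation_module :: "(('g::ab_group_add \<Rightarrow>\<^sub>0 int) \<Rightarrow> 'p::ab_group_add \<Rightarrow> 'p) \<Rightarrow> bool"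
  where "permutation_module t \<longleftrightarrow>
    module t \<and> (\<exists>B. int_basis t B \<and> (\<forall>g. \<forall>b\<in>B. act t g b \<in> B))"

definition direct_summand ::
    "(('g::ab_group_add \<Rightarrow>\<^sub>0 int) \<Rightarrow> 'p::ab_group_add \<Rightarrow> 'p) \<Rightarrow> 'p set \<Rightarrow> bool"
  where "direct_summand t A \<longleftrightarrow> module.subspace t A \<and>
    (\<exists>C. module.subspace t C \<and> A \<inter> C = {0} \<and> (\<forall>x. \<exists>a\<in>A. \<exists>c\<in>C. x = a + c))"

definition isomorphic_to_summand ::
    "(('g::ab_group_add \<Rightarrow>\<^sub>0 int) \<Rightarrow> 'm::ab_group_add \<Rightarrow> 'm) \<Rightarrow>
     (('g \<Rightarrow>\<^sub>0 int) \<Rightarrow> 'p::ab_group_add \<Rightarrow> 'p) \<Rightarrow> bool"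
  where "isomorphic_to_summand s t \<longleftrightarrow>
    (\<exists>f. module_hom s t f \<and> inj f \<and> direct_summand t (range f))"

text \<open>
  A type has to be fixed for the permutation module in the existential quantifier.  The type
  \<^typ>\<open>('m \<times> nat) \<Rightarrow>\<^sub>0 int\<close> (with its usual addition and an arbitrary module structure) is large enough:
  lemma \<open>permutation_projectiveI\<close> below shows that a module isomorphic to a direct summand of a
  permutation module on any type whatsoever is permutation projective in this sense.
\<close>

definition permutation_projective ::
    "(('g::ab_group_add \<Rightarrow>\<^sub>0 int) \<Rightarrow> 'm::ab_group_add \<Rightarrow> 'm) \<Rightarrow> bool"
  where "permutation_projective s \<longleftrightarrow>
    (\<exists>t :: ('g \<Rightarrow>\<^sub>0 int) \<Rightarrow> (('m \<times> nat) \<Rightarrow>\<^sub>0 int) \<Rightarrow> (('m \<times> nat) \<Rightarrow>\<^sub>0 int).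
       permutation_module t \<and> isomorphic_to_summand s t)"

definition is_subgroup :: "'g::ab_group_add set \<Rightarrow> bool"
  where "is_subgroup H \<longleftrightarrow> 0 \<in> H \<and> (\<forall>g\<in>H. \<forall>h\<in>H. g + h \<in> H) \<and> (\<forall>g\<in>H. - g \<in> H)"

text \<open>
  First group cohomology \<open>H\<^sup>1(H, M)\<close> as crossed homomorphisms modulo principal ones (inhomogeneous
  cochains).  Functions on the subgroup \<open>H\<close> are represented by their extensional extensions.
\<close>

definition cocycles1 ::
    "(('g::ab_group_add \<Rightarrow>\<^sub>0 int) \<Rightarrow> 'm::ab_group_add \<Rightarrow> 'm) \<Rightarrow> 'g set \<Rightarrow> ('g \<Rightarrow> 'm) set"
  where "cocycles1 s H = {c \<in> extensional H. \<forall>g\<in>H. \<forall>h\<in>H. c (g + h) = c g + act s g (c h)}"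

definition coboundaries1 ::
    "(('g::ab_group_add \<Rightarrow>\<^sub>0 int) \<Rightarrow> 'm::ab_group_add \<Rightarrow> 'm) \<Rightarrow> 'g set \<Rightarrow> ('g \<Rightarrow> 'm) set"
  where "coboundaries1 s H = range (\<lambda>x. restrict (\<lambda>g. act s g x - x) H)"

definition cohomology1 ::
    "(('g::ab_group_add \<Rightarrow>\<^sub>0 int) \<Rightarrow> 'm::ab_group_add \<Rightarrow> 'm) \<Rightarrow> 'g set \<Rightarrow> ('g \<Rightarrow> 'm) set set"
  where "cohomology1 s H = cocycles1 s H //
    {(c, d). c \<in> cocycles1 s H \<and> d \<in> cocycles1 s H \<and>
             restrict (\<lambda>g. c g - d g) H \<in> coboundaries1 s H}"

text \<open>
  Vanishing of \<open>H\<^sup>1\<close> says that its only element is the zero class, which is the set of coboundaries.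
\<close>

definition coflasque :: "(('g::ab_group_add \<Rightarrow>\<^sub>0 int) \<Rightarrow> 'm::ab_group_add \<Rightarrow> 'm) \<Rightarrow> bool"
  where "coflasque s \<longleftrightarrow> module s \<and> (\<exists>B. int_basis s B) \<and>
    (\<forall>H. is_subgroup H \<longrightarrow> cohomology1 s H = {coboundaries1 s H})"

lemma cohomology1_trivial_iff:
  assumes s: "module s" and H: "is_subgroup H"
  shows "cohomology1 s H = {coboundaries1 s H} \<longleftrightarrow> cocycles1 s H \<subseteq> coboundaries1 s H"
proof -
  interpret module s by fact
  let ?Z = "cocycles1 s H" and ?B = "coboundaries1 s H"
  let ?r = "{(c, d). c \<in> ?Z \<and> d \<in> ?Z \<and> restrict (\<lambda>g. c g - d g) H \<in> ?B}"
  have zero: "restrict (\<lambda>g. 0) H \<in> ?B"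
    unfolding coboundaries1_def by (rule range_eqI[of _ _ 0]) (simp add: act_def)
  have BZ: "?B \<subseteq> ?Z"
    using H unfolding coboundaries1_def cocycles1_def
    by (auto simp: is_subgroup_def act_def algebra_simps mult_single)
  have diff: "restrict (\<lambda>g. c g - d g) H \<in> ?B" if "c \<in> ?B" "d \<in> ?B" for c d
  proof -
    obtain x y where xy: "c = restrict (\<lambda>g. act s g x - x) H" "d = restrict (\<lambda>g. act s g y - y) H"
      using \<open>c \<in> ?B\<close> \<open>d \<in> ?B\<close> unfolding coboundaries1_def by blast
    show ?thesis unfolding coboundaries1_def
      by (rule range_eqI[of _ _ "x - y"]) (auto simp: xy act_def algebra_simps restrict_def)
  qed
  show ?thesis
  proof
    assume triv: "cohomology1 s H = {?B}"
    show "?Z \<subseteq> ?B"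
    proof
      fix c assume c: "c \<in> ?Z"
      then have "?r `` {c} \<in> cohomology1 s H" unfolding cohomology1_def by (rule quotientI)
      moreover have "c \<in> ?r `` {c}" using c zero by simp
      ultimately show "c \<in> ?B" using triv by blast
    qed
  next
    assume "?Z \<subseteq> ?B"
    with BZ have eq: "?Z = ?B" by blast
    have "?r `` {c} = ?B" if "c \<in> ?B" for c using that diff by (auto simp: eq)
    then show "cohomology1 s H = {?B}"
      unfolding cohomology1_def quotient_def using zero by (auto simp: eq)
  qed
qed

lemma of_int_poly_mapping: "(of_int n :: 'g::monoid_add \<Rightarrow>\<^sub>0 int) = Poly_Mapping.single 0 n"
proof -
  have "Poly_Mapping.single (0::'g) (of_int n :: int) = of_int n" by (rule single_of_int)
  then show ?thesis by (simp only: of_int_eq_id id_apply)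
qed

lemma module_int_scale:
  assumes "module s" shows "module (int_scale s)"
proof -
  interpret module s by fact
  show ?thesis by unfold_locales (simp_all add: int_scale_def algebra_simps)
qed

lemma additive_int_scale:
  assumes "module s" "module t" "\<And>x y. h (x + y) = h x + h y"
  shows "h (int_scale s n x) = int_scale t n (h x)"
proof -
  interpret s: module "int_scale s" by (rule module_int_scale) fact
  interpret t: module "int_scale t" by (rule module_int_scale) fact
  interpret h: additive h by unfold_locales (rule assms)
  have nat: "h (int_scale s (of_nat k) x) = int_scale t (of_nat k) (h x)" for k
    by (induction k) (simp_all add: s.scale_left_distrib t.scale_left_distrib assms(3) h.zero)
  show ?thesis
    by (cases n rule: int_cases2) (simp_all only: nat s.scale_minus_left t.scale_minus_left h.minus)
qed

lemma module_homI_act: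
  assumes s: "module s" and t: "module t" and add: "\<And>x y. h (x + y) = h x + h y"
    and act: "\<And>g x. h (act s g x) = act t g (h x)"
  shows "module_hom s t h"
proof -
  interpret s: module s by fact
  interpret t: module t by fact
  interpret h: additive h by unfold_locales (rule add)
  have "h (s r x) = t r (h x)" for r x
    using subset_UNIV[of "Poly_Mapping.keys r"]
  proof (induction r rule: frag_induction)
    case zero then show ?case by (simp add: h.zero)
  next
    case (one g) then show ?case using act[of g x] by (simp add: act_def)
  next
    case (diff a b)
    then show ?case by (simp add: s.scale_left_diff_distrib t.scale_left_diff_distrib h.diff)
  qed
  then show ?thesis
    by (intro module_hom.intro s t) (unfold_locales, auto simp: add)
qed

lemma direct_summand_iff_retract:
  assumes f: "module_hom s t f" and inj: "inj f"
  shows "direct_summand t (range f) \<longleftrightarrow> (\<exists>q. module_hom t s q \<and> (\<forall>m. q (f m) = m))"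
proof
  interpret f: module_hom s t f by fact
  assume "direct_summand t (range f)"
  then obtain C where C: "f.m2.subspace C" "range f \<inter> C = {0}"
    and ex: "\<And>x. \<exists>m. \<exists>c\<in>C. x = f m + c"
    unfolding direct_summand_def by auto
  define q where "q x = (SOME m. x - f m \<in> C)" for x
  have q: "x - f (q x) \<in> C" for x
    unfolding q_def by (rule someI_ex) (metis ex[of x] add_diff_cancel_left')
  have uniq: "m = q x" if "x - f m \<in> C" for m x
  proof -
    have "(x - f (q x)) - (x - f m) \<in> C" by (intro f.m2.subspace_diff C q that)
    then have "f (m - q x) \<in> range f \<inter> C" by (auto simp flip: f.diff)
    then have "f (m - q x) = f 0" using C(2) by (simp add: f.zero)
    from injD[OF inj this] show ?thesis by simp
  qed
  have "module_hom t s q"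
  proof (intro module_hom.intro f.m1.module_axioms f.m2.module_axioms, unfold_locales)
    fix x y
    have "(x - f (q x)) + (y - f (q y)) \<in> C" by (intro f.m2.subspace_add C q)
    then show "q (x + y) = q x + q y"
      by (intro uniq[symmetric]) (simp add: f.add algebra_simps)
  next
    fix r x
    have "t r (x - f (q x)) \<in> C" by (intro f.m2.subspace_scale C q)
    then show "q (t r x) = s r (q x)"
      by (intro uniq[symmetric]) (simp add: f.scale f.m2.scale_right_diff_distrib)
  qed
  moreover have "q (f m) = m" for m
    by (rule uniq[symmetric]) (simp add: f.m2.subspace_0[OF C(1)])
  ultimately show "\<exists>q. module_hom t s q \<and> (\<forall>m. q (f m) = m)" by blast
next
  interpret f: module_hom s t f by fact
  assume "\<exists>q. module_hom t s q \<and> (\<forall>m. q (f m) = m)"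
  then obtain q where "module_hom t s q" and qf: "\<And>m. q (f m) = m" by blast
  then interpret q: module_hom t s q by blast
  let ?C = "{x. q x = 0}"
  have "f.m2.subspace ?C"
    by (rule f.m2.subspaceI) (auto simp: q.zero q.add q.scale)
  moreover have "f.m2.subspace (range f)"
    by (rule f.subspace_image) (rule f.m1.subspace_UNIV)
  moreover have "range f \<inter> ?C = {0}"
    using f.zero by (auto simp: qf q.zero intro: range_eqI[of _ _ 0])
  moreover have "\<exists>a\<in>range f. \<exists>c\<in>?C. x = a + c" for x
    by (rule bexI[of _ "f (q x)"], rule bexI[of _ "x - f (q x)"]) (simp_all add: q.diff qf)
  ultimately show "direct_summand t (range f)" unfolding direct_summand_def by blast
qed

definition perm_scale ::
    "('g::ab_group_add \<Rightarrow> 'x \<Rightarrow> 'x) \<Rightarrow> ('g \<Rightarrow>\<^sub>0 int) \<Rightarrow> ('x \<Rightarrow>\<^sub>0 int) \<Rightarrow> ('x \<Rightarrow>\<^sub>0 int)"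
  where "perm_scale a r x = frag_extend (\<lambda>g. frag_extend (\<lambda>y. frag_of (a g y)) x) r"

lemma act_perm_scale: "act (perm_scale a) g x = frag_extend (\<lambda>y. frag_of (a g y)) x"
  by (simp add: act_def perm_scale_def)

lemma frag_extend_add_fun: "frag_extend (\<lambda>y. u y + v y) x = frag_extend u x + frag_extend v x"
  by (simp add: frag_extend_def frag_cmul_distrib2 sum.distrib)

lemma frag_extend_diff_fun: "frag_extend (\<lambda>y. u y - v y) x = frag_extend u x - frag_extend v x"
  using frag_extend_add_fun[of "\<lambda>y. u y - v y" v x] by simp


lemma module_perm_scale:
  fixes a :: "'g::ab_group_add \<Rightarrow> 'x \<Rightarrow> 'x"
  assumes a0: "\<And>y. a 0 y = y" and a_add: "\<And>g h y. a (g + h) y = a g (a h y)"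
  shows "module (perm_scale a)"
proof
  fix r r' :: "'g \<Rightarrow>\<^sub>0 int" and x y :: "'x \<Rightarrow>\<^sub>0 int"
  show "perm_scale a r (x + y) = perm_scale a r x + perm_scale a r y"
    by (simp add: perm_scale_def frag_extend_add frag_extend_add_fun)
  show "perm_scale a (r + r') x = perm_scale a r x + perm_scale a r' x"
    by (simp add: perm_scale_def frag_extend_add)
  show "perm_scale a 1 x = x"
     by (simp add: perm_scale_def a0 flip: single_one frag_expansion)
  have basic: "perm_scale a (frag_of g) (perm_scale a (frag_of h) x)
      = perm_scale a (frag_of g * frag_of h) x" for g h
    using subset_UNIV[of "Poly_Mapping.keys x"]
    by (induction x rule: frag_induction)
      (simp_all add: perm_scale_def mult_single a_add frag_extend_diff)
  have two: "perm_scale a (frag_of g) (perm_scale a r' x) = perm_scale a (frag_of g * r') x" for g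
    using subset_UNIV[of "Poly_Mapping.keys r'"]
  proof (induction r' rule: frag_induction)
    case zero then show ?case by (simp add: perm_scale_def frag_extend_eq_0)
  next
    case (one h) show ?case by (rule basic)
  next
    case (diff u v)
    then show ?case by (simp add: perm_scale_def frag_extend_diff frag_extend_diff_fun right_diff_distrib)
  qed
  show "perm_scale a r (perm_scale a r' x) = perm_scale a (r * r') x"
    using subset_UNIV[of "Poly_Mapping.keys r"]
  proof (induction r rule: frag_induction)
    case zero then show ?case by (simp add: perm_scale_def frag_extend_eq_0)
  next
    case (one g) show ?case by (rule two)
  next
    case (diff u v)
    then show ?case by (simp add: perm_scale_def frag_extend_diff left_diff_distrib)
  qed
qed


lemma int_scale_perm_scale:
  assumes "\<And>y. a 0 y = y"
  shows "int_scale (perm_scale a) n x = frag_cmul n x"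
  using frag_expansion[of x]
  by (simp add: int_scale_def perm_scale_def of_int_poly_mapping frag_extend_def assms)

lemma permutation_module_perm_scale:
  fixes a :: "'g::ab_group_add \<Rightarrow> 'x \<Rightarrow> 'x"
  assumes a0: "\<And>y. a 0 y = y" and a_add: "\<And>g h y. a (g + h) y = a g (a h y)"
  shows "permutation_module (perm_scale a)"
proof -
  have m: "module (perm_scale a)" by (rule module_perm_scale) fact+
  interpret i: module "int_scale (perm_scale a)" by (rule module_int_scale) (rule m)
  note sc = int_scale_perm_scale[of a, OF a0]
  have "i.independent (range frag_of)"
    unfolding i.independent_explicit_module
  proof (intro allI impI)
    fix T u and v :: "'x \<Rightarrow>\<^sub>0 int"
    assume T: "finite T" "T \<subseteq> range frag_of" "(\<Sum>v\<in>T. int_scale (perm_scale a) (u v) v) = 0" "v \<in> T"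
    then obtain y where y: "v = frag_of y" by auto
    have "0 = Poly_Mapping.lookup (\<Sum>v\<in>T. int_scale (perm_scale a) (u v) v) y"
      using T by simp
    also have "\<dots> = (\<Sum>w\<in>T. u w * Poly_Mapping.lookup w y)"
      by (simp add: lookup_sum sc)
    also have "\<dots> = (\<Sum>w\<in>T. if w = v then u v else 0)"
      using T(2) by (intro sum.cong) (auto simp: y frag_of_eq)
    also have "\<dots> = u v" using T by simp
    finally show "u v = 0" by simp
  qed
  moreover have "x \<in> i.span (range frag_of)" for x
    by (subst frag_expansion[of x], unfold frag_extend_def sc[symmetric])
      (intro i.span_sum i.span_scale i.span_base rangeI)
  ultimately show ?thesis
    unfolding permutation_module_def int_basis_def
    by (intro conjI m exI[of _ "range frag_of"]) (auto simp: act_perm_scale)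
qed


theorem permutation_projectiveI:
  fixes s :: "('g::ab_group_add \<Rightarrow>\<^sub>0 int) \<Rightarrow> 'm::ab_group_add \<Rightarrow> 'm"
    and t :: "('g \<Rightarrow>\<^sub>0 int) \<Rightarrow> 'p::ab_group_add \<Rightarrow> 'p"
  assumes perm: "permutation_module t" and summand: "isomorphic_to_summand s t"
  shows "permutation_projective s"
proof -
  obtain f where f: "module_hom s t f" "inj f" "direct_summand t (range f)"
    using summand unfolding isomorphic_to_summand_def by blast
  obtain q where q: "module_hom t s q" and qf: "\<And>m. q (f m) = m"
    using f direct_summand_iff_retract by blast
  interpret f: module_hom s t f by fact
  interpret q: module_hom t s q by fact
  interpret i: module "int_scale t" by (rule module_int_scale) (rule f.m2.module_axioms)
  obtain B where B: "i.independent B" "\<And>x. x \<in> i.span B"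
    and B_act: "\<And>g b. b \<in> B \<Longrightarrow> act t g b \<in> B"
    using perm unfolding permutation_module_def int_basis_def by auto
  have act_0: "act t 0 x = x" for x by (simp add: act_def)
  have act_add: "act t (g + h) x = act t g (act t h x)" for g h x
    by (simp add: act_def mult_single)
  have act_plus: "act t g (x + y) = act t g x + act t g y" for g x y
    by (simp add: act_def f.m2.scale_right_distrib)
  have act_minus: "act t (- g) (act t g x) = x" "act t g (act t (- g) x) = x" for g x
    by (simp_all add: act_0 flip: act_add)
  define R where "R = i.representation B"
  have R: "R v b \<noteq> 0 \<Longrightarrow> b \<in> B" "finite {b. R v b \<noteq> 0}"
      "(\<Sum>b | R v b \<noteq> 0. int_scale t (R v b) b) = v" for v b
    unfolding R_def
    by (auto intro: i.representation_ne_zero i.finite_representation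
        i.sum_nonzero_representation_eq[OF B])
  have R_act: "R (act t g v) b = R v (act t (- g) b)" for g v b
  proof -
    have bij: "bij_betw (act t g) {b. R v b \<noteq> 0} {b. R v (act t (- g) b) \<noteq> 0}"
      by (rule bij_betw_byWitness[of _ "act t (- g)"]) (auto simp: act_minus)
    have "R (act t g v) = (\<lambda>b. R v (act t (- g) b))"
      unfolding R_def
    proof (rule i.representation_eqI[OF B], fold R_def)
      show "b \<in> B" if "R v (act t (- g) b) \<noteq> 0" for b
        using B_act[OF R(1)[OF that], of g] by (simp add: act_minus)
      show "finite {b. R v (act t (- g) b) \<noteq> 0}"
        using bij_betw_finite[OF bij] R(2) by simp
      have "(\<Sum>b | R v (act t (- g) b) \<noteq> 0. int_scale t (R v (act t (- g) b)) b)
          = (\<Sum>b | R v b \<noteq> 0. int_scale t (R v b) (act t g b))"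
        by (subst sum.reindex_bij_betw[OF bij, symmetric]) (simp add: act_minus)
      also have "\<dots> = (\<Sum>b | R v b \<noteq> 0. act t g (int_scale t (R v b) b))"
        by (simp add: act_def int_scale_def mult.commute)
      also have "\<dots> = act t g v"
        by (subst (2) R(3)[of v, symmetric]) (simp add: act_def f.m2.scale_sum_right)
      finally show "(\<Sum>b | R v (act t (- g) b) \<noteq> 0. int_scale t (R v (act t (- g) b)) b)
        = act t g v" .
    qed
    then show ?thesis by simp
  qed
  define X where "X = {b. \<exists>m. R (f m) b \<noteq> 0}"
  have X_B: "X \<subseteq> B" using R(1) by (auto simp: X_def)
  have f_act: "f (act s g m) = act t g (f m)" for g m by (simp add: act_def f.scale)
  have X_act: "act t g b \<in> X" if bX: "b \<in> X" for g b
  proof -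
    obtain m where "R (f m) b \<noteq> 0" using bX unfolding X_def by blast
    then have "R (f (act s g m)) (act t g b) \<noteq> 0" by (simp add: f_act R_act act_minus)
    then show ?thesis unfolding X_def by blast
  qed
  obtain j :: "'p \<Rightarrow> 'm \<times> nat" where j: "inj_on j X"
  proof -
    have "\<forall>b\<in>X. \<exists>m. R (f m) b \<noteq> 0" by (simp add: X_def)
    then obtain c where c: "\<And>b. b \<in> X \<Longrightarrow> R (f (c b)) b \<noteq> 0" by metis
    have "\<forall>m. \<exists>e :: 'p \<Rightarrow> nat. inj_on e {b. R (f m) b \<noteq> 0}"
      using finite_imp_inj_to_nat_seg[OF R(2)] by blast
    then obtain e :: "'m \<Rightarrow> 'p \<Rightarrow> nat" where e: "\<And>m. inj_on (e m) {b. R (f m) b \<noteq> 0}" by metis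
    have "inj_on (\<lambda>b. (c b, e (c b) b)) X"
    proof (rule inj_onI)
      fix x y assume xy: "x \<in> X" "y \<in> X" "(c x, e (c x) x) = (c y, e (c y) y)"
      then show "x = y" using c[of x] c[of y] e[of "c x"] by (auto dest: inj_onD)
    qed
    then show ?thesis by (rule that)
  qed
  define k where "k = inv_into X j"
  have kj: "k (j b) = b" if "b \<in> X" for b using that j by (simp add: k_def)
  have k_X: "k y \<in> X" "j (k y) = y" if "y \<in> j ` X" for y
    using that by (auto simp: kj)
  define a where "a g y = (if y \<in> j ` X then j (act t g (k y)) else y)" for g y
  have a_Y: "a g y \<in> j ` X" if "y \<in> j ` X" for g y
    using that by (auto simp: a_def kj X_act)
  have a0: "a 0 y = y" for y by (auto simp: a_def act_0 kj)
  have a_j: "a g (j b) = j (act t g b)" if "b \<in> X" for g b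
    using that by (simp add: a_def kj)
  have a_add: "a (g + h) y = a g (a h y)" for g h y
    by (cases "y \<in> j ` X") (auto simp: a_j act_add X_act, simp add: a_def)
  let ?t = "perm_scale a"
  have perm': "permutation_module ?t" by (rule permutation_module_perm_scale) (fact a0 a_add)+
  then have m': "module ?t" by (simp add: permutation_module_def)
  define w where "w y = (if y \<in> j ` X then k y else 0)" for y
  define \<iota> where "\<iota> x = (\<Sum>y\<in>Poly_Mapping.keys x. int_scale t (Poly_Mapping.lookup x y) (w y))" for x
  have \<iota>_sup: "\<iota> x = (\<Sum>y\<in>S. int_scale t (Poly_Mapping.lookup x y) (w y))"
    if "finite S" "Poly_Mapping.keys x \<subseteq> S" for x S
    unfolding \<iota>_def using that by (intro sum.mono_neutral_left) (auto simp: in_keys_iff)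
  have \<iota>_add: "\<iota> (x + y) = \<iota> x + \<iota> y" for x y
    using keys_add[of x y]
    by (simp add: \<iota>_sup[of "Poly_Mapping.keys x \<union> Poly_Mapping.keys y"] lookup_add
        i.scale_left_distrib sum.distrib)
  interpret \<iota>: additive \<iota> by unfold_locales (rule \<iota>_add)
  have \<iota>_of: "\<iota> (frag_of y) = w y" for y by (simp add: \<iota>_def)
  have \<iota>_act: "\<iota> (act ?t g x) = act t g (\<iota> x)" for g x
    using subset_UNIV[of "Poly_Mapping.keys x"]
  proof (induction x rule: frag_induction)
    case zero then show ?case by (simp add: \<iota>.zero act_perm_scale act_def[of t])
  next
    case (one y)
    then show ?case
    proof (cases "y \<in> j ` X")
      case True
      then obtain b where "b \<in> X" "y = j b" by blast
      then show ?thesis by (simp add: act_perm_scale \<iota>_of w_def a_j kj X_act)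
    next
      case False
      then show ?thesis by (simp add: act_perm_scale \<iota>_of w_def a_def act_def[of t])
    qed
  next
    case (diff x y)
    then show ?case
      by (simp add: act_perm_scale frag_extend_diff \<iota>.diff act_def[of t]
          f.m2.scale_right_diff_distrib)
  qed
  have \<iota>_hom: "module_hom ?t t \<iota>"
    by (rule module_homI_act[OF m' f.m2.module_axioms \<iota>_add \<iota>_act])
  have \<iota>_inj: "x = 0" if x: "Poly_Mapping.keys x \<subseteq> j ` X" "\<iota> x = 0" for x
  proof -
    let ?K = "Poly_Mapping.keys x"
    have inj: "inj_on k ?K" by (rule inj_on_inverseI[of _ j]) (use x k_X in blast)
    have "0 = (\<Sum>y\<in>?K. int_scale t (Poly_Mapping.lookup x (j (k y))) (k y))"
      unfolding x(2)[symmetric] \<iota>_def using x(1) by (intro sum.cong) (auto simp: w_def kj)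
    also have "\<dots> = (\<Sum>b\<in>k ` ?K. int_scale t (Poly_Mapping.lookup x (j b)) b)"
      using inj by (simp add: sum.reindex)
    finally have z: "(\<Sum>b\<in>k ` ?K. int_scale t (Poly_Mapping.lookup x (j b)) b) = 0" by simp
    have "Poly_Mapping.lookup x y = 0" if y: "y \<in> ?K" for y
    proof -
      have "k ` ?K \<subseteq> B" using x(1) X_B k_X by blast
      from i.independentD[OF B(1) _ this z, of "k y"] y
      have "Poly_Mapping.lookup x (j (k y)) = 0" by simp
      moreover have "j (k y) = y" using y x(1) k_X by blast
      ultimately show ?thesis by simp
    qed
    then show ?thesis by (intro poly_mapping_eqI) (metis in_keys_iff lookup_zero)
  qed
  have ex: "\<exists>x. Poly_Mapping.keys x \<subseteq> j ` X \<and> \<iota> x = f m" for m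
  proof -
    let ?K = "{b. R (f m) b \<noteq> 0}"
    let ?x = "\<Sum>b\<in>?K. frag_cmul (R (f m) b) (frag_of (j b))"
    have KX: "?K \<subseteq> X" by (auto simp: X_def)
    have keys: "Poly_Mapping.keys ?x \<subseteq> j ` X"
      by (rule order_trans[OF keys_sum]) (use KX in auto)
    have "\<iota> (frag_cmul n (frag_of y)) = int_scale t n (w y)" for n y
      using \<iota>_sup[of "{y}" "frag_cmul n (frag_of y)"] keys_cmul[of n "frag_of y"] by simp
    then have "\<iota> ?x = (\<Sum>b\<in>?K. int_scale t (R (f m) b) (w (j b)))" by (simp add: \<iota>.sum)
    also have "\<dots> = (\<Sum>b\<in>?K. int_scale t (R (f m) b) b)"
      using KX by (intro sum.cong) (auto simp: w_def kj subset_iff)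
    finally have "\<iota> ?x = f m" by (simp add: R)
    with keys show ?thesis by blast
  qed
  define f' where "f' m = (SOME x. Poly_Mapping.keys x \<subseteq> j ` X \<and> \<iota> x = f m)" for m
  have f': "Poly_Mapping.keys (f' m) \<subseteq> j ` X" "\<iota> (f' m) = f m" for m
    using someI_ex[OF ex[of m]] by (auto simp: f'_def)
  have uniq: "f' m = x" if "Poly_Mapping.keys x \<subseteq> j ` X" "\<iota> x = f m" for x m
    using \<iota>_inj[of "f' m - x"] f'[of m] that keys_diff[of "f' m" x] by (auto simp: \<iota>.diff)
  have f'_hom: "module_hom s ?t f'"
  proof (rule module_homI_act[OF f.m1.module_axioms m'])
    show "f' (x + y) = f' x + f' y" for x y
      by (rule uniq) (use keys_add[of "f' x" "f' y"] f' in \<open>auto simp: \<iota>_add f.add\<close>)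
    show "f' (act s g x) = act ?t g (f' x)" for g x
    proof (rule uniq)
      show "Poly_Mapping.keys (act ?t g (f' x)) \<subseteq> j ` X"
        unfolding act_perm_scale
        by (rule order_trans[OF keys_frag_extend]) (use f'(1)[of x] a_Y in \<open>unfold keys_frag_of, blast\<close>)
    qed (simp add: \<iota>_act f' f_act)
  qed
  have q'_hom: "module_hom ?t s (q \<circ> \<iota>)" by (rule module_hom_compose[OF \<iota>_hom q])
  have q'f': "(q \<circ> \<iota>) (f' m) = m" for m by (simp add: f' qf)
  have "inj f'" by (rule inj_on_inverseI) (rule q'f')
  moreover have "direct_summand ?t (range f')"
    using direct_summand_iff_retract[OF f'_hom \<open>inj f'\<close>] q'_hom q'f' by blast
  ultimately have "isomorphic_to_summand s ?t"
    unfolding isomorphic_to_summand_def using f'_hom by blast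
  then show ?thesis unfolding permutation_projective_def using perm' by blast
qed

end

theory Submission
  imports Defs
begin

text \<open>
  Let \<open>\<sigma>\<close> generate \<open>\<Gamma>\<close>, of order \<open>p ^ n\<close>, and let \<open>M\<close> be coflasque.  Let \<open>P\<close> be the free abelian group on the
  set \<open>M\<close>, a permutation module, and \<open>f : P \<rightarrow> M\<close> the evaluation map.  For each subgroup
  \<open>\<Gamma>'\<close> it is onto on fixed points, since a fixed point \<open>m\<close> is the image of the basis element of \<open>m\<close>.
  As \<open>P\<close> has no first cohomology, neither has the kernel \<open>N\<close>.  It has to be shown that \<open>f\<close> splits.

  The main point is that \<open>f\<close> splits modulo \<open>p\<close>.  Put \<open>t = \<sigma> - 1\<close>; then \<open>(\<int>/p)\<Gamma>\<close> is the truncated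
  polynomial ring \<open>(\<int>/p)[t] / t ^ (p ^ n)\<close>, and a surjection of modules over it (of any rank) splits as soon as every
  element killed by \<open>t ^ i\<close> lifts to an element killed by \<open>t ^ i\<close>, for all \<open>i\<close> (\<open>complement_mod_p\<close>).
  Since \<open>t ^ (p ^ j)\<close> agrees with \<open>\<sigma> ^ (p ^ j) - 1\<close> modulo \<open>p\<close>, for \<open>i = p ^ j\<close> one has to lift fixed points
  of \<open>M / p\<close> to fixed points of \<open>P / p\<close>, and they do lift because \<open>M\<close> and \<open>N\<close> have no first cohomology.  The other
  exponents follow because the Jordan blocks of \<open>t\<close> on \<open>M / p\<close> have sizes that are powers of \<open>p\<close>
  (\<open>block_decomposition\<close>).  This is deduced from the arithmetic of \<open>\<zeta> - 1\<close> in the ring \<open>\<int>[\<zeta>]\<close> of a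
  root of unity \<open>\<zeta>\<close> of order \<open>p ^ (j + 1)\<close>, which acts on the quotient of two successive modules of fixed points.

  A splitting modulo \<open>p\<close> is the same as a submodule of \<open>P\<close> that maps onto \<open>M\<close> with kernel \<open>p N\<close>.
  This kernel is isomorphic to \<open>N\<close>, so the step can be repeated, and after \<open>n\<close> steps there is a submodule
  \<open>E\<close> that maps onto \<open>M\<close> with kernel \<open>p ^ n N\<close> (\<open>norm_exact_cover_iterate\<close>).  Because \<open>M\<close> is free over \<open>\<int>\<close>, it has
  a \<open>\<int>\<close>-linear section into \<open>E\<close>, and the average of its conjugates over the \<open>p ^ n\<close> elements of \<open>\<Gamma>\<close> is an equivariant
  section of \<open>f\<close> with values in \<open>P\<close> (\<open>averaged_section\<close>).
\<close>

section \<open>The group ring of a cyclic \<open>p\<close>-group\<close>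

lemma of_nat_dvd_of_natI: "a dvd b \<Longrightarrow> (of_nat a :: 'a::comm_ring_1) dvd of_nat b"
  by (auto elim!: dvdE)

text \<open>
  The remainder is divisible by \<open>p * u\<close>, not only by \<open>p\<close>: in a group ring \<open>u\<close> may be a zero
  divisor, so that the factor cannot be recovered afterwards.
\<close>

lemma binomial_dvd_remainder:
  fixes u :: "'a::comm_ring_1"
  assumes "prime p"
  shows "\<exists>d. (1 + u) ^ p = 1 + u ^ p + of_nat p * u * d"
proof -
  have p: "1 < p" using assms by (rule prime_gt_1_nat)
  have "(1 + u) ^ p = (\<Sum>k\<le>p. of_nat (p choose k) * u ^ k)"
    using binomial_ring[of u 1 p] by (simp add: add.commute)
  also have "{..p} = {0, p} \<union> {1..<p}" using p by auto
  also have "(\<Sum>k\<in>{0, p} \<union> {1..<p}. of_nat (p choose k) * u ^ k)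
      = 1 + u ^ p + (\<Sum>k\<in>{1..<p}. of_nat (p choose k) * u ^ k)"
    using p by (subst sum.union_disjoint) auto
  also have "of_nat p * u dvd (\<Sum>k\<in>{1..<p}. of_nat (p choose k) * u ^ k)"
  proof (rule dvd_sum)
    fix k assume k: "k \<in> {1..<p}"
    have "p dvd (p choose k)" using k assms by (intro dvd_choose_prime) auto
    then show "of_nat p * u dvd of_nat (p choose k) * u ^ k"
      using k by (intro mult_dvd_mono of_nat_dvd_of_natI dvd_power) auto
  qed
  then obtain d where "(\<Sum>k\<in>{1..<p}. of_nat (p choose k) * u ^ k) = of_nat p * u * d" ..
  finally show ?thesis by blast
qed

lemma geometric_sum_binomial:
  fixes w :: "'a::comm_ring_1"
  shows "(\<Sum>l<m. (1 + w) ^ l) = (\<Sum>k<m. of_nat (m choose Suc k) * w ^ k)"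
proof (induction m)
  case (Suc m)
  have "(\<Sum>l<Suc m. (1 + w) ^ l)
      = (\<Sum>k<m. of_nat (m choose Suc k) * w ^ k) + (\<Sum>k\<le>m. of_nat (m choose k) * w ^ k)"
    using Suc binomial_ring[of w 1 m] by (simp add: add.commute)
  also have "\<dots> = (\<Sum>k<Suc m. of_nat (m choose Suc k) * w ^ k) + (\<Sum>k<Suc m. of_nat (m choose k) * w ^ k)"
    unfolding lessThan_Suc_atMost[symmetric] by (simp only: sum.lessThan_Suc, simp add: binomial_eq_0)
  also have "\<dots> = (\<Sum>k<Suc m. of_nat (Suc m choose Suc k) * w ^ k)"
    by (simp only: sum.distrib[symmetric] binomial_Suc_Suc of_nat_add distrib_right add.commute)
  finally show ?case .
qed simp

lemma dvd_power_difference: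
  fixes a b :: "'a::comm_ring_1"
  shows "a - b dvd a ^ k - b ^ k"
  by (metis dvd_triv_left power_diff_sumr2)

text \<open>
  The properties of \<open>\<int>\<Gamma>\<close> that matter, for \<open>\<Gamma>\<close> cyclic of order \<open>p ^ n\<close> with generator \<open>1 + t\<close>: the last
  assumption says that \<open>t\<close> generates the augmentation ideal.
\<close>

locale cyclic_p_ring =
  fixes t :: "'r::comm_ring_1" and p n :: nat
  assumes prime_p: "prime p"
    and generator_order: "(1 + t) ^ (p ^ n) = 1"
    and generated: "\<And>r. \<exists>a b. r = of_int a + t * b"
begin

text \<open>
  Write \<open>\<Gamma>\<^sub>j\<close> for the subgroup generated by \<open>\<sigma> ^ (p ^ j)\<close>, where \<open>\<sigma> = 1 + t\<close>.  The elements of a module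
  that are annihilated by \<open>augm j\<close> are the fixed points of \<open>\<Gamma>\<^sub>j\<close>; \<open>full_norm j\<close> is the norm element of
  \<open>\<Gamma>\<^sub>j\<close>, and \<open>rel_norm j\<close> acts on the fixed points of \<open>\<Gamma>\<^bsub>j+1\<^esub>\<close> as the norm of \<open>\<Gamma>\<^sub>j / \<Gamma>\<^bsub>j+1\<^esub>\<close>.
\<close>

definition augm :: "nat \<Rightarrow> 'r" where
  "augm j = (1 + t) ^ (p ^ j) - 1"

definition rel_norm :: "nat \<Rightarrow> 'r" where
  "rel_norm j = (\<Sum>l<p. (1 + t) ^ (p ^ j * l))"

definition full_norm :: "nat \<Rightarrow> 'r" where
  "full_norm j = (\<Sum>l<p ^ (n - j). (1 + t) ^ (p ^ j * l))"

lemma augm_top: "augm n = 0"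
  by (simp add: augm_def generator_order)

lemma augm_mult_rel_norm: "augm j * rel_norm j = augm (Suc j)"
  using power_diff_1_eq[of "(1 + t) ^ p ^ j" p]
  by (simp add: augm_def rel_norm_def power_mult[symmetric] mult.commute)

lemma augm_mult_full_norm: "j \<le> n \<Longrightarrow> augm j * full_norm j = 0"
  using power_diff_1_eq[of "(1 + t) ^ p ^ j" "p ^ (n - j)"] generator_order
  by (simp add: augm_def full_norm_def power_mult[symmetric] mult.commute power_add[symmetric])

lemma full_norm_Suc:
  assumes "j < n"
  shows "full_norm j = full_norm (Suc j) * rel_norm j"
proof -
  let ?x = "(1 + t) ^ (p ^ j)"
  have "n - j = Suc (n - Suc j)" using assms by simp
  then have "full_norm j = (\<Sum>l<p ^ (n - Suc j) * p. ?x ^ l)"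
    by (simp add: full_norm_def power_mult mult.commute[of _ p])
  also have "\<dots> = (\<Sum>i<p ^ (n - Suc j). \<Sum>l\<in>{i * p..<i * p + p}. ?x ^ l)"
    by (rule sum.nat_group[symmetric])
  also have "\<dots> = (\<Sum>i<p ^ (n - Suc j). \<Sum>l<p. ?x ^ (i * p) * ?x ^ l)"
  proof (rule sum.cong[OF refl])
    fix i
    show "(\<Sum>l\<in>{i * p..<i * p + p}. ?x ^ l) = (\<Sum>l<p. ?x ^ (i * p) * ?x ^ l)"
      by (subst power_add[symmetric], rule sum.reindex_bij_witness[of _ "\<lambda>l. i * p + l" "\<lambda>l. l - i * p"]) auto
  qed
  also have "\<dots> = full_norm (Suc j) * rel_norm j"
    by (simp only: full_norm_def rel_norm_def sum_product) (simp add: power_mult[symmetric] ac_simps)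
  finally show ?thesis .
qed

lemma t_dvd_augm: "t dvd augm j"
  using dvd_power_difference[of "1 + t" 1] by (simp add: augm_def)

text \<open>
  Modulo \<open>p\<close> the fixed points of \<open>\<Gamma>\<^sub>j\<close> are thus the kernel of \<open>t ^ (p ^ j)\<close>.
\<close>

lemma augm_expand: "\<exists>c. augm j = t ^ (p ^ j) + of_nat p * t * c"
proof (induction j)
  case 0 then show ?case by (auto simp: augm_def intro: exI[of _ 0])
next
  case (Suc j)
  then obtain c where c: "augm j = t ^ (p ^ j) + of_nat p * t * c" by blast
  obtain d where d: "(1 + augm j) ^ p = 1 + augm j ^ p + of_nat p * augm j * d"
    using binomial_dvd_remainder[OF prime_p] by blast
  obtain e where e: "augm j ^ p - (t ^ (p ^ j)) ^ p = of_nat p * t * c * e"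
    using dvd_power_difference[of "augm j" "t ^ (p ^ j)" p] c by (auto elim: dvdE)
  obtain a where a: "augm j = t * a" using t_dvd_augm by (rule dvdE)
  have "augm (Suc j) = (1 + augm j) ^ p - 1"
    by (simp add: augm_def power_mult[symmetric] mult.commute)
  also have "\<dots> = (t ^ (p ^ j)) ^ p + of_nat p * t * (c * e + a * d)"
    using e unfolding d by (simp add: a algebra_simps)
  also have "(t ^ (p ^ j)) ^ p = t ^ (p ^ Suc j)"
    by (simp add: power_mult[symmetric] mult.commute)
  finally show ?case by blast
qed

lemma rel_norm_augm: "\<exists>e. rel_norm j = of_nat p + augm j * e"
proof -
  have "rel_norm j - of_nat p = (\<Sum>l<p. ((1 + t) ^ (p ^ j)) ^ l - 1)"
    by (simp add: rel_norm_def sum_subtractf power_mult)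
  also have "augm j dvd \<dots>"
    unfolding augm_def by (intro dvd_sum) (metis dvd_power_difference power_one)
  finally show ?thesis by (metis add.commute diff_add_cancel dvdE)
qed

text \<open>
  This is the reason why \<open>p\<close> becomes a multiple of \<open>t ^ (p ^ j * (p - 1))\<close> wherever the relative norm
  acts as zero, as in the cyclotomic ring of level \<open>p ^ (j + 1)\<close>: the factor \<open>1 + t * r\<close> is
  invertible modulo every power of \<open>t\<close>.
\<close>

lemma rel_norm_expand: "\<exists>r. rel_norm j = t ^ (p ^ j * (p - 1)) + of_nat p * (1 + t * r)"
proof -
  let ?w = "augm j"
  have p: "1 < p" using prime_p by (rule prime_gt_1_nat)
  have "rel_norm j = (\<Sum>k<p. of_nat (p choose Suc k) * ?w ^ k)"
    using geometric_sum_binomial[of ?w p] by (simp add: rel_norm_def augm_def power_mult)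
  also have "{..<p} = {0, p - 1} \<union> {1..<p - 1}" using p by auto
  also have "(\<Sum>k\<in>{0, p - 1} \<union> {1..<p - 1}. of_nat (p choose Suc k) * ?w ^ k)
      = of_nat p + ?w ^ (p - 1) + (\<Sum>k\<in>{1..<p - 1}. of_nat (p choose Suc k) * ?w ^ k)"
    using p by (subst sum.union_disjoint) auto
  finally have expand: "rel_norm j = of_nat p + ?w ^ (p - 1)
      + (\<Sum>k\<in>{1..<p - 1}. of_nat (p choose Suc k) * ?w ^ k)" .
  have "of_nat p * t dvd (\<Sum>k\<in>{1..<p - 1}. of_nat (p choose Suc k) * ?w ^ k)"
  proof (rule dvd_sum)
    fix k assume k: "k \<in> {1..<p - 1}"
    have "p dvd (p choose Suc k)" using k prime_p by (intro dvd_choose_prime) auto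
    moreover have "t dvd ?w ^ k"
      by (rule dvd_trans[OF t_dvd_augm dvd_power]) (use k in auto)
    ultimately show "of_nat p * t dvd of_nat (p choose Suc k) * ?w ^ k"
      by (intro mult_dvd_mono of_nat_dvd_of_natI)
  qed
  then obtain d where d: "(\<Sum>k\<in>{1..<p - 1}. of_nat (p choose Suc k) * ?w ^ k) = of_nat p * t * d" ..
  obtain c where "?w = t ^ (p ^ j) + of_nat p * t * c" using augm_expand by blast
  then obtain e where "?w ^ (p - 1) - (t ^ (p ^ j)) ^ (p - 1) = of_nat p * t * c * e"
    using dvd_power_difference[of ?w "t ^ (p ^ j)" "p - 1"] by (auto elim: dvdE)
  then have e: "?w ^ (p - 1) = t ^ (p ^ j * (p - 1)) + of_nat p * t * (c * e)"
    unfolding power_mult by (simp add: algebra_simps)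
  have "rel_norm j = t ^ (p ^ j * (p - 1)) + of_nat p * (1 + t * (c * e + d))"
    unfolding expand d e by (simp only: distrib_left mult_1_right) (simp add: ac_simps)
  then show ?thesis by blast
qed

end

section \<open>Jordan blocks of a coflasque module modulo \<open>p\<close>\<close>

text \<open>
  Kernel of the norm modulo image of \<open>\<sigma> ^ (p ^ j) - 1\<close> is the Tate cohomology group in degree \<open>-1\<close> of
  \<open>\<Gamma>\<^sub>j\<close>; since \<open>\<Gamma>\<^sub>j\<close> is cyclic it is isomorphic to the first cohomology group.  Norm exactness is
  therefore the vanishing condition in the definition of coflasque modules.
\<close>

locale norm_exact_lattice = cyclic_p_ring t p n + module scale
  for t :: "'r::comm_ring_1" and p n :: nat
    and scale :: "'r \<Rightarrow> 'm::ab_group_add \<Rightarrow> 'm" (infixr \<open>*s\<close> 75) +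
  assumes torsion_free: "\<And>x. of_nat p *s x = 0 \<Longrightarrow> x = 0"
    and norm_exact: "\<And>j x. j \<le> n \<Longrightarrow> full_norm j *s x = 0 \<Longrightarrow> \<exists>y. x = augm j *s y"
begin

lemma scale_fixed: "augm k *s y = 0 \<Longrightarrow> augm k *s r *s y = 0"
  by (metis scale_left_commute scale_zero_right)

lemma t_power_fixed:
  assumes "augm k *s a = 0" shows "\<exists>e. t ^ (p ^ k) *s a = of_nat p *s e *s a"
proof -
  obtain c where "augm k = t ^ (p ^ k) + of_nat p * t * c" using augm_expand by blast
  with assms have "t ^ (p ^ k) *s a = of_nat p *s (- (t * c)) *s a"
    by (simp add: scale_left_distrib mult.assoc eq_neg_iff_add_eq_0)
  then show ?thesis ..
qed

text \<open>
  Fixed points of \<open>\<Gamma>\<^sub>j\<close> in \<open>M / p\<close> come from fixed points in \<open>M\<close>, because the connecting map sends them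
  to the first cohomology of \<open>\<Gamma>\<^sub>j\<close>, which vanishes.
\<close>

lemma lift_fixed_mod_p:
  assumes j: "j \<le> n" and m: "t ^ (p ^ j) *s m = of_nat p *s x"
  shows "\<exists>a b. augm j *s a = 0 \<and> m = a + of_nat p *s b"
proof -
  obtain c where c: "augm j = t ^ (p ^ j) + of_nat p * t * c" using augm_expand by blast
  define m' where "m' = x + (t * c) *s m"
  have m': "augm j *s m = of_nat p *s m'"
    by (simp add: c m m'_def scale_left_distrib scale_right_distrib mult.assoc)
  have "of_nat p *s (full_norm j *s m') = (augm j * full_norm j) *s m"
    using m' by (metis mult.commute scale_scale)
  then have "full_norm j *s m' = 0" using torsion_free by (simp add: augm_mult_full_norm[OF j])
  then obtain b where "m' = augm j *s b" using norm_exact[OF j] by blast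
  then have "augm j *s (m - of_nat p *s b) = 0"
    by (simp add: scale_right_diff_distrib m' mult.commute)
  then show ?thesis by (metis diff_add_cancel)
qed

text \<open>
  Fix \<open>j\<close>, and let \<open>X\<close> be the module of fixed points of \<open>\<Gamma>\<^bsub>j+1\<^esub>\<close> and \<open>X'\<close> that of \<open>\<Gamma>\<^sub>j\<close>.  The
  relative norm annihilates \<open>X / X'\<close>, which makes it a module over \<open>\<int>[\<zeta>]\<close> with \<open>\<zeta>\<close> a root of unity of
  order \<open>p ^ (j + 1)\<close>, where \<open>t\<close> acts as \<open>\<zeta> - 1\<close>.  An equation in \<open>X / X'\<close> is expressed by applying \<open>augm j\<close> to
  both sides.
\<close>

context
  fixes j :: nat
  assumes j: "j < n"
begin

lemma rel_norm_fixed: "augm j *s z = 0 \<Longrightarrow> rel_norm j *s z = of_nat p *s z"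
  using rel_norm_augm[of j] by (auto simp: scale_left_distrib mult.commute simp flip: scale_scale)

text \<open>
  By inflation \<open>\<Gamma>\<^sub>j / \<Gamma>\<^bsub>j+1\<^esub>\<close> has no first cohomology with values in \<open>X\<close> either: exactness for \<open>\<Gamma>\<^sub>j\<close> gives
  \<open>y'\<close>, which lies in \<open>X\<close> because \<open>augm (Suc j)\<close> sends it to the relative norm of \<open>y\<close>.
\<close>

lemma rel_norm_exact:
  assumes y: "rel_norm j *s y = 0"
  shows "\<exists>y'. y = augm j *s y' \<and> augm (Suc j) *s y' = 0"
proof -
  have "full_norm j *s y = full_norm (Suc j) *s rel_norm j *s y"
    by (simp add: full_norm_Suc[OF j])
  then have "full_norm j *s y = 0" using y by simp
  then obtain y' where y': "y = augm j *s y'" using norm_exact[of j y] j by auto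
  have "augm (Suc j) *s y' = rel_norm j *s y"
    by (simp add: y' augm_mult_rel_norm[symmetric] mult.commute)
  with y y' show ?thesis by auto
qed

text \<open>
  Multiplication by \<open>t\<close> is injective on \<open>X / X'\<close>: if \<open>t * y\<close> lies in \<open>X'\<close>, then \<open>z = augm j *s y\<close> is fixed by
  \<open>\<Gamma>\<^sub>j\<close>, so the relative norm multiplies it by \<open>p\<close>; but it also annihilates every element of this form.
\<close>

lemma t_cancel_mod_fixed:
  assumes y: "augm (Suc j) *s y = 0" and ty: "augm j *s t ^ r *s y = 0"
  shows "augm j *s y = 0"
proof -
  have step: "augm j *s y = 0" if y: "augm (Suc j) *s y = 0" and ty: "augm j *s t *s y = 0" for y
  proof -
    obtain e where e: "augm j = t * e" using t_dvd_augm by (rule dvdE)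
    let ?z = "augm j *s y"
    have "augm j *s ?z = e *s (augm j *s t *s y)"
      by (subst e) (simp add: mult_ac)
    then have "rel_norm j *s ?z = of_nat p *s ?z"
      using ty by (intro rel_norm_fixed) (simp only: scale_zero_right)
    moreover have "rel_norm j *s ?z = 0"
      using y by (simp add: augm_mult_rel_norm[symmetric] mult.commute)
    ultimately show ?thesis using torsion_free by metis
  qed
  show ?thesis using ty
  proof (induction r)
    case (Suc r)
    have "augm j *s t *s (t ^ r *s y) = 0" using Suc.prems by simp
    moreover have "augm (Suc j) *s (t ^ r *s y) = 0"
      using y by (simp only: scale_fixed)
    ultimately have "augm j *s t ^ r *s y = 0" by (rule step[rotated])
    then show ?case by (rule Suc.IH)
  qed simp
qed

text \<open>
  In \<open>\<int>[\<zeta>]\<close> the element \<open>p\<close> is \<open>(\<zeta> - 1) ^ (p ^ j * (p - 1))\<close> times a unit.  The unit is not inverted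
  here: since the norm acts as zero, \<open>p * y = - t ^ d * y - t * r * p * y\<close>, and each use of this identity
  gains one factor \<open>t\<close>, until \<open>d\<close> of them have been collected.
\<close>

lemma p_divisible_by_t_mod_fixed:
  assumes "augm (Suc j) *s y = 0"
  shows "\<exists>v. augm (Suc j) *s v = 0 \<and> augm j *s of_nat p *s y = augm j *s t ^ (p ^ j * (p - 1)) *s v"
proof -
  define d where "d = p ^ j * (p - 1)"
  obtain r where r: "rel_norm j = t ^ d + of_nat p * (1 + t * r)"
    unfolding d_def using rel_norm_expand by blast
  have "\<exists>v. augm (Suc j) *s v = 0 \<and> augm j *s of_nat p *s y = augm j *s t ^ k *s v"
    if "k \<le> d" "augm (Suc j) *s y = 0" for k y
    using that
  proof (induction k arbitrary: y)
    case 0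
    then have "augm (Suc j) *s of_nat p *s y = 0" by (simp only: scale_fixed)
    then show ?case by (intro exI[of _ "of_nat p *s y"]) simp
  next
    case (Suc k)
    have ry: "augm (Suc j) *s r *s y = 0"
      using Suc.prems by (simp only: scale_fixed)
    obtain v where v: "augm (Suc j) *s v = 0"
        "augm j *s of_nat p *s (r *s y) = augm j *s t ^ k *s v"
      using Suc.IH[OF _ ry] Suc.prems by auto
    let ?v = "- (t ^ (d - Suc k) *s y) - v"
    have "0 = augm j *s rel_norm j *s y"
      using Suc.prems by (simp add: augm_mult_rel_norm)
    also have "\<dots> = augm j *s t ^ d *s y + augm j *s of_nat p *s y + t *s (augm j *s of_nat p *s (r *s y))"
      by (simp add: r algebra_simps)
    also have "t *s (augm j *s of_nat p *s (r *s y)) = augm j *s t ^ Suc k *s v"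
      by (simp only: v(2)) (simp add: algebra_simps)
    also have "t ^ d = t ^ Suc k * t ^ (d - Suc k)"
      using Suc.prems by (simp only: power_add[symmetric] le_add_diff_inverse)
    finally have "augm j *s of_nat p *s y = augm j *s t ^ Suc k *s ?v"
      by (simp add: scale_right_diff_distrib algebra_simps eq_neg_iff_add_eq_0)
    moreover have "augm (Suc j) *s ?v = 0"
      using Suc.prems v(1)
      by (simp only: scale_right_diff_distrib scale_minus_right scale_fixed minus_zero diff_self)
    ultimately show ?case by blast
  qed
  from this[OF order_refl assms] show ?thesis unfolding d_def .
qed

text \<open>
  The hypothesis makes the relative norm of \<open>y\<close> divisible by \<open>p\<close>, and the quotient \<open>z\<close> is fixed by \<open>\<Gamma>\<^sub>j\<close>.
  Hence \<open>y\<close> and \<open>z\<close> have the same norm, and exactness applies to the difference.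
\<close>

lemma split_off_fixed_part:
  assumes y: "augm (Suc j) *s y = 0" and ty: "t ^ (p ^ j * (p - 1)) *s y = of_nat p *s x"
  shows "\<exists>a y'. y = a + augm j *s y' \<and> augm j *s a = 0 \<and> augm (Suc j) *s y' = 0"
proof -
  obtain r where r: "rel_norm j = t ^ (p ^ j * (p - 1)) + of_nat p * (1 + t * r)"
    using rel_norm_expand by blast
  define z where "z = x + (1 + t * r) *s y"
  have z: "rel_norm j *s y = of_nat p *s z"
    using ty by (simp add: r z_def scale_left_distrib[of "t ^ _"] scale_right_distrib)
  have "of_nat p *s augm j *s z = augm j *s rel_norm j *s y"
    by (simp only: z) (simp add: mult.commute)
  then have "augm j *s z = 0" using y torsion_free by (simp add: augm_mult_rel_norm)
  then have "rel_norm j *s (y - z) = 0"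
    by (simp add: scale_right_diff_distrib z rel_norm_fixed)
  then obtain y' where "y - z = augm j *s y'" "augm (Suc j) *s y' = 0"
    using rel_norm_exact by blast
  with \<open>augm j *s z = 0\<close> show ?thesis by (metis add.commute diff_add_cancel)
qed

text \<open>
  The Jordan blocks of \<open>t\<close> on \<open>M / p\<close> have sizes that are powers of \<open>p\<close>.  Indeed, if all sizes are
  powers of \<open>p\<close> and \<open>i\<close> lies between \<open>p ^ j\<close> and \<open>p ^ (j + 1)\<close>, then the kernel of \<open>t ^ i\<close> is spanned by
  the blocks of size at most \<open>p ^ j\<close> and by the multiples by \<open>t ^ (p ^ (j + 1) - i)\<close> of elements that
  \<open>t ^ (p ^ (j + 1))\<close> annihilates; this is the property that is proved.
\<close>

lemma block_decomposition:
  assumes i: "p ^ j \<le> i" "i \<le> p ^ Suc j" and m: "t ^ i *s m = of_nat p *s x"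
  shows "\<exists>a b c. m = a + t ^ (p ^ Suc j - i) *s b + of_nat p *s c
    \<and> augm j *s a = 0 \<and> augm (Suc j) *s b = 0"
proof -
  define q where "q = p ^ j"
  define d where "d = q * (p - 1)"
  have "p \<ge> 2" using prime_p by (rule prime_ge_2_nat)
  then have pq: "p ^ Suc j = q + d" and qd: "q \<le> d"
    by (cases p; simp add: q_def d_def)+
  obtain c where c: "augm j = t ^ q + of_nat p * t * c" using augm_expand q_def by blast
  have "t ^ (p ^ Suc j) *s m = t ^ (p ^ Suc j - i) *s t ^ i *s m"
    using i by (simp flip: power_add)
  also have "\<dots> = of_nat p *s t ^ (p ^ Suc j - i) *s x" unfolding m by (rule scale_left_commute)
  finally obtain m1 c0 where m1: "augm (Suc j) *s m1 = 0" and mm1: "m = m1 + of_nat p *s c0"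
    using lift_fixed_mod_p[of "Suc j"] j by (metis Suc_leI)
  define x1 where "x1 = x - t ^ i *s c0"
  have x1: "t ^ i *s m1 = of_nat p *s x1"
    using m by (simp add: mm1 x1_def scale_right_distrib scale_right_diff_distrib mult.commute eq_diff_eq)
  have "of_nat p *s augm (Suc j) *s x1 = t ^ i *s augm (Suc j) *s m1"
    using x1 by (metis scale_left_commute)
  then have Xx1: "augm (Suc j) *s x1 = 0" using torsion_free m1 by simp
  show ?thesis
  proof (cases "i \<le> d")
    case True
    \<comment> \<open>In \<open>X / X'\<close> the element \<open>t ^ i * m1 = p * x1\<close> is divisible by \<open>t ^ d\<close>, so \<open>m1\<close> is \<open>t ^ (d - i) * v\<close>
      there; as \<open>t ^ d * v\<close> is again divisible by \<open>p\<close>, the missing factor \<open>t ^ q\<close> comes from splitting \<open>v\<close>.\<close>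
    obtain v where v: "augm (Suc j) *s v = 0" "augm j *s of_nat p *s x1 = augm j *s t ^ d *s v"
      using p_divisible_by_t_mod_fixed[OF Xx1] by (auto simp: d_def q_def)
    define a where "a = m1 - t ^ (d - i) *s v"
    have ti: "t ^ i * t ^ (d - i) = t ^ d" using True by (simp flip: power_add)
    have "augm j *s t ^ i *s a = augm j *s t ^ i *s m1 - augm j *s (t ^ i * t ^ (d - i)) *s v"
      by (simp add: a_def scale_right_diff_distrib mult.assoc)
    also have "\<dots> = 0" by (simp only: x1 v ti diff_self)
    finally have "augm j *s t ^ i *s a = 0" .
    moreover have "augm (Suc j) *s a = 0"
      unfolding a_def scale_right_diff_distrib by (simp only: m1 scale_fixed[OF v(1)] diff_self)
    ultimately have a: "augm j *s a = 0" by (intro t_cancel_mod_fixed[of a i])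
    obtain e where e: "t ^ q *s a = of_nat p *s e *s a"
      using t_power_fixed[OF a] unfolding q_def by blast
    have "t ^ d *s v = t ^ i *s m1 - t ^ i *s a"
      by (simp add: a_def scale_right_diff_distrib ti)
    also have "t ^ i *s a = t ^ (i - q) *s t ^ q *s a"
      using i by (simp add: q_def flip: power_add)
    also have "t ^ i *s m1 - \<dots> = of_nat p *s (x1 - t ^ (i - q) *s e *s a)"
      by (simp only: x1 e scale_right_diff_distrib scale_left_commute)
    finally have "t ^ d *s v = of_nat p *s (x1 - t ^ (i - q) *s e *s a)" .
    then obtain a' v' where v': "v = a' + augm j *s v'" "augm j *s a' = 0" "augm (Suc j) *s v' = 0"
      using split_off_fixed_part[OF v(1)] unfolding d_def q_def by blast
    have "m = a + t ^ (d - i) *s v + of_nat p *s c0" by (simp add: mm1 a_def)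
    also have "\<dots> = (a + t ^ (d - i) *s a') + (t ^ (d - i) * t ^ q) *s v'
        + of_nat p *s (c0 + (t ^ (d - i) * t * c) *s v')"
      by (simp add: v'(1) c scale_right_distrib scale_left_distrib algebra_simps)
    also have "t ^ (d - i) * t ^ q = t ^ (p ^ Suc j - i)"
      using True pq by (simp add: add.commute flip: power_add)
    finally have "m = (a + t ^ (d - i) *s a') + t ^ (p ^ Suc j - i) *s v'
        + of_nat p *s (c0 + (t ^ (d - i) * t * c) *s v')" .
    moreover have "augm j *s (a + t ^ (d - i) *s a') = 0"
      unfolding scale_right_distrib by (simp only: a scale_fixed[OF v'(2)] add_0)
    ultimately show ?thesis using v'(3) by blast
  next
    case False
    \<comment> \<open>The splitting now applies to \<open>t ^ (i - d) * m1\<close> and shows it to be divisible by \<open>t ^ q\<close> in \<open>X / X'\<close>,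
      where the surplus power of \<open>t\<close> is then cancelled.\<close>
    define r where "r = i - d"
    have r: "r \<le> q" "d + r = i" "q - r = p ^ Suc j - i" using False i pq by (auto simp: r_def)
    define y where "y = t ^ r *s m1"
    have "t ^ d *s y = of_nat p *s x1"
      using x1 by (simp add: y_def r flip: power_add)
    then obtain a' y' where y': "y = a' + augm j *s y'" "augm j *s a' = 0" "augm (Suc j) *s y' = 0"
      using split_off_fixed_part[of y] scale_fixed[OF m1] unfolding d_def q_def y_def by blast
    obtain v where v: "augm (Suc j) *s v = 0"
        "augm j *s of_nat p *s (t * c) *s y' = augm j *s t ^ d *s v"
      using p_divisible_by_t_mod_fixed[OF scale_fixed[OF y'(3)]] unfolding d_def q_def by blast
    define w where "w = y' + t ^ (d - q) *s v"
    define a where "a = m1 - t ^ (q - r) *s w"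
    have w: "augm (Suc j) *s w = 0"
      unfolding w_def scale_right_distrib by (simp only: y' scale_fixed[OF v(1)] add_0)
    have "augm j *s y = augm j *s (t ^ q *s y' + of_nat p *s (t * c) *s y')"
      using y'(1,2) by (simp add: scale_right_distrib c scale_left_distrib mult.assoc)
    also have "\<dots> = augm j *s t ^ q *s y' + augm j *s (t ^ q * t ^ (d - q)) *s v"
      using qd by (simp only: scale_right_distrib v(2) power_add[symmetric] le_add_diff_inverse)
    also have "\<dots> = augm j *s t ^ q *s w"
      by (simp add: w_def scale_right_distrib mult.assoc)
    also have "t ^ q = t ^ r * t ^ (q - r)"
      using r(1) by (simp only: power_add[symmetric] le_add_diff_inverse)
    finally have "augm j *s t ^ r *s a = 0"
      by (simp add: a_def y_def scale_right_diff_distrib mult.assoc)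
    moreover have "augm (Suc j) *s a = 0"
      unfolding a_def scale_right_diff_distrib by (simp only: m1 scale_fixed[OF w] diff_self)
    ultimately have "augm j *s a = 0" by (intro t_cancel_mod_fixed[of a r])
    moreover have "m = a + t ^ (p ^ Suc j - i) *s w + of_nat p *s c0"
      by (simp add: mm1 a_def r)
    ultimately show ?thesis using w by blast
  qed
qed

end

end

section \<open>Covers with norm exact kernel are pure modulo \<open>p\<close>\<close>

text \<open>
  A submodule \<open>E\<close> that \<open>f\<close> maps onto \<open>M\<close> with a norm exact kernel.  The submodule varies, while the ambient module
  and \<open>f\<close> stay the same: this avoids forming new module types for the successive covers of \<open>M\<close>.
\<close>

locale norm_exact_cover =
  norm_exact_lattice t p n s + hom: module_hom u s f
  for t :: "'r::comm_ring_1" and p n :: nat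
    and s :: "'r \<Rightarrow> 'm::ab_group_add \<Rightarrow> 'm" (infixr \<open>*s\<close> 75)
    and u :: "'r \<Rightarrow> 'e::ab_group_add \<Rightarrow> 'e" (infixr \<open>*u\<close> 75)
    and f :: "'e \<Rightarrow> 'm" +
  fixes E :: "'e set"
  assumes subspace_E: "hom.m1.subspace E"
    and onto: "f ` E = UNIV"
    and kernel_norm_exact: "\<And>j x. j \<le> n \<Longrightarrow> x \<in> E \<Longrightarrow> f x = 0 \<Longrightarrow> full_norm j *u x = 0
      \<Longrightarrow> \<exists>y\<in>E. f y = 0 \<and> x = augm j *u y"
begin

lemma lift: obtains x where "x \<in> E" "f x = m"
  using onto by (metis UNIV_I imageE)

text \<open>
  A preimage \<open>x\<close> of the fixed point \<open>a\<close> fails to be fixed by an element \<open>augm j *u x\<close> of the kernel.  Its norm is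
  zero, so by exactness it can be produced within the kernel and subtracted.
\<close>

lemma lift_fixed:
  assumes j: "j \<le> n" and a: "augm j *s a = 0"
  shows "\<exists>x\<in>E. f x = a \<and> augm j *u x = 0"
proof -
  obtain x where x: "x \<in> E" "f x = a" by (rule lift)
  let ?y = "augm j *u x"
  have "full_norm j *u ?y = 0" using augm_mult_full_norm[OF j] by (simp add: mult.commute)
  then obtain z where z: "z \<in> E" "f z = 0" "?y = augm j *u z"
    using kernel_norm_exact[OF j, of ?y] x a subspace_E
    by (auto simp: hom.scale hom.m1.subspace_scale)
  have "f (x - z) = a" "augm j *u (x - z) = 0" "x - z \<in> E"
    using x z subspace_E by (auto simp: hom.diff hom.m1.scale_right_diff_distrib hom.m1.subspace_diff)
  then show ?thesis by blast
qed

lemma t_power_fixed_cover: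
  assumes "augm k *u a = 0" shows "\<exists>e. t ^ (p ^ k) *u a = of_nat p *u e *u a"
proof -
  obtain c where "augm k = t ^ (p ^ k) + of_nat p * t * c" using augm_expand by blast
  with assms have "t ^ (p ^ k) *u a = of_nat p *u (- (t * c)) *u a"
    by (simp add: hom.m1.scale_left_distrib mult.assoc eq_neg_iff_add_eq_0)
  then show ?thesis ..
qed

text \<open>
  Purity of the kernel in \<open>E / p\<close>: elements killed by \<open>t ^ i\<close> lift to elements killed by \<open>t ^ i\<close>.
  When \<open>i\<close> is a power of \<open>p\<close> these are fixed points and lift because the kernel has no first
  cohomology.  The block decomposition reduces all other exponents to this case.
\<close>

lemma cover_pure_mod_p:
  assumes m: "t ^ i *s m = of_nat p *s m'"
  shows "\<exists>x\<in>E. \<exists>e\<in>E. f x = m \<and> t ^ i *u x = of_nat p *u e"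
proof -
  note E = hom.m1.subspace_add[OF subspace_E] hom.m1.subspace_scale[OF subspace_E]
  consider "i = 0" | "p ^ n \<le> i" | "1 \<le> i" "i < p ^ n" by linarith
  then show ?thesis
  proof cases
    case 1
    obtain e where e: "e \<in> E" "f e = m'" by (rule lift)
    then show ?thesis using 1 m E(2)[OF e(1)]
      by (intro bexI[of _ "of_nat p *u e"] bexI[of _ e]) (auto simp: hom.scale)
  next
    case 2
    obtain x where x: "x \<in> E" "f x = m" by (rule lift)
    obtain e where e: "t ^ (p ^ n) *u x = of_nat p *u e *u x"
      using t_power_fixed_cover[of n x] by (auto simp: augm_top)
    have "t ^ i *u x = t ^ (i - p ^ n) *u t ^ (p ^ n) *u x"
      using 2 by (simp flip: power_add)
    also have "\<dots> = of_nat p *u t ^ (i - p ^ n) *u e *u x"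
      by (simp only: e hom.m1.scale_left_commute)
    finally show ?thesis using x E(2)[OF E(2)[OF x(1)]] by blast
  next
    case 3
    obtain j where j: "p ^ j \<le> i" "i < p ^ (j + 1)"
      using ex_power_ivl1[of p i] prime_ge_2_nat[OF prime_p] 3 by auto
    have "j < n"
      using j 3 prime_gt_1_nat[OF prime_p] by (meson le_less_trans power_less_imp_less_exp)
    obtain a b c where abc: "m = a + t ^ (p ^ Suc j - i) *s b + of_nat p *s c"
        "augm j *s a = 0" "augm (Suc j) *s b = 0"
      using block_decomposition[OF \<open>j < n\<close> j(1) _ m] j(2) by auto
    obtain xa where xa: "xa \<in> E" "f xa = a" "augm j *u xa = 0"
      using lift_fixed[OF _ abc(2)] \<open>j < n\<close> by auto
    obtain xb where xb: "xb \<in> E" "f xb = b" "augm (Suc j) *u xb = 0"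
      using lift_fixed[OF _ abc(3)] \<open>j < n\<close> by auto
    obtain xc where xc: "xc \<in> E" "f xc = c" by (rule lift)
    obtain ea where ea: "t ^ (p ^ j) *u xa = of_nat p *u ea *u xa"
      using t_power_fixed_cover[OF xa(3)] by blast
    obtain eb where eb: "t ^ (p ^ Suc j) *u xb = of_nat p *u eb *u xb"
      using t_power_fixed_cover[OF xb(3)] by blast
    let ?x = "xa + t ^ (p ^ Suc j - i) *u xb + of_nat p *u xc"
    let ?e = "t ^ (i - p ^ j) *u ea *u xa + eb *u xb + t ^ i *u xc"
    have "t ^ i *u ?x = t ^ (i - p ^ j) *u t ^ (p ^ j) *u xa + t ^ (p ^ Suc j) *u xb
        + of_nat p *u t ^ i *u xc"
      using j by (simp add: hom.m1.scale_right_distrib mult.commute flip: power_add)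
    also have "\<dots> = of_nat p *u ?e"
      unfolding ea eb by (simp only: hom.m1.scale_right_distrib hom.m1.scale_left_commute)
    finally have "t ^ i *u ?x = of_nat p *u ?e" .
    moreover have "f ?x = m" by (simp add: abc(1) xa xb xc hom.add hom.scale)
    moreover have "?x \<in> E" "?e \<in> E" by (intro E xa xb xc)+
    ultimately show ?thesis by blast
  qed
qed

end

section \<open>Splitting a cover modulo \<open>p\<close>\<close>

context norm_exact_cover
begin

text \<open>
  A submodule \<open>G\<close> that contains \<open>p E\<close> and meets the preimage of \<open>p M\<close> only in \<open>p E\<close> is a partial
  section of \<open>E / p \<rightarrow> M / p\<close>, namely the inverse of the injection \<open>G / p E \<rightarrow> M / p\<close>.  By Zorn's lemma the one given
  by \<open>H\<close> extends to all of \<open>f ` S\<close>: since \<open>t\<close> maps \<open>S\<close> into \<open>H\<close>, adjoining an element \<open>x\<close> of \<open>S\<close> adds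
  only integer multiples of \<open>x\<close>, and no new relation arises because \<open>p\<close> is prime.
\<close>

lemma maximal_complement:
  assumes H: "hom.m1.subspace H" and S: "hom.m1.subspace S"
    and HS: "H \<subseteq> S" and SE: "S \<subseteq> E" and pH: "(*u) (of_nat p) ` E \<subseteq> H"
    and tS: "\<And>x. x \<in> S \<Longrightarrow> t *u x \<in> H"
    and H_pure: "\<And>x m. x \<in> H \<Longrightarrow> f x = of_nat p *s m \<Longrightarrow> x \<in> (*u) (of_nat p) ` E"
  shows "\<exists>G. hom.m1.subspace G \<and> H \<subseteq> G \<and> G \<subseteq> S \<and> f ` S \<subseteq> f ` G
    \<and> (\<forall>x\<in>G. \<forall>m. f x = of_nat p *s m \<longrightarrow> x \<in> (*u) (of_nat p) ` E)"
proof -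
  let ?pE = "(*u) (of_nat p) ` E"
  define A where "A = {G. hom.m1.subspace G \<and> H \<subseteq> G \<and> G \<subseteq> S
    \<and> (\<forall>x\<in>G. \<forall>m. f x = of_nat p *s m \<longrightarrow> x \<in> ?pE)}"
  have "\<exists>G\<in>A. \<forall>X\<in>A. G \<subseteq> X \<longrightarrow> X = G"
  proof (rule subset_Zorn_nonempty)
    show "A \<noteq> {}" using H HS H_pure by (auto simp: A_def)
    fix C assume C: "C \<noteq> {}" "subset.chain A C"
    have sub: "hom.m1.subspace X" if "X \<in> C" for X using C that by (auto simp: A_def subset.chain_def)
    have "hom.m1.subspace (\<Union>C)"
    proof (rule hom.m1.subspaceI)
      show "0 \<in> \<Union>C" using C(1) sub hom.m1.subspace_0 by blast
      show "c *u x \<in> \<Union>C" if "x \<in> \<Union>C" for c x using that sub hom.m1.subspace_scale by blast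
      fix x y assume "x \<in> \<Union>C" "y \<in> \<Union>C"
      then obtain X Y where XY: "X \<in> C" "Y \<in> C" "x \<in> X" "y \<in> Y" by blast
      then have "X \<subseteq> Y \<or> Y \<subseteq> X" using C(2) by (auto simp: subset.chain_def)
      then show "x + y \<in> \<Union>C" using XY sub hom.m1.subspace_add by (metis UnionI subsetD)
    qed
    moreover have "H \<subseteq> X \<and> X \<subseteq> S \<and> (\<forall>x\<in>X. \<forall>m. f x = of_nat p *s m \<longrightarrow> x \<in> ?pE)" if "X \<in> C" for X
    proof -
      have "X \<in> A" using C(2) that by (auto simp: subset.chain_def)
      then show ?thesis unfolding A_def by blast
    qed
    ultimately show "\<Union>C \<in> A" using C(1) unfolding A_def by (intro CollectI conjI) (assumption | blast)+
  qed
  then obtain G where GA: "G \<in> A" and max: "\<And>X. X \<in> A \<Longrightarrow> G \<subseteq> X \<Longrightarrow> X = G" by blast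
  then have G: "hom.m1.subspace G" "H \<subseteq> G" "G \<subseteq> S"
    and G_pure: "\<And>x m. x \<in> G \<Longrightarrow> f x = of_nat p *s m \<Longrightarrow> x \<in> ?pE"
    by (auto simp: A_def)
  note closed = hom.m1.subspace_add[OF G(1)] hom.m1.subspace_scale[OF G(1)]
    hom.m1.subspace_diff[OF G(1)] hom.m1.subspace_neg[OF G(1)]
  have pM: "\<exists>g\<in>G. f g = of_nat p *s m" for m
  proof -
    obtain e where "e \<in> E" "f e = m" by (rule lift)
    then show ?thesis using pH G(2) by (intro bexI[of _ "of_nat p *u e"]) (auto simp: hom.scale)
  qed
  have "f x \<in> f ` G" if x: "x \<in> S" for x
  proof (rule ccontr)
    assume not: "f x \<notin> f ` G"
    define G' where "G' = {g + r *u x | g r. g \<in> G}"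
    have "hom.m1.subspace G'"
    proof (rule hom.m1.subspaceI)
      show "0 \<in> G'" unfolding G'_def using hom.m1.subspace_0[OF G(1)]
        by (intro CollectI exI[of _ 0]) simp
      show "y + z \<in> G'" if "y \<in> G'" "z \<in> G'" for y z
      proof -
        obtain g r where y: "y = g + r *u x" "g \<in> G"
          using \<open>y \<in> G'\<close> by (auto simp: G'_def)
        obtain g' r' where z: "z = g' + r' *u x" "g' \<in> G"
          using \<open>z \<in> G'\<close> by (auto simp: G'_def)
        show ?thesis unfolding G'_def
          by (intro CollectI exI[of _ "g + g'"] exI[of _ "r + r'"])
            (simp add: y z closed hom.m1.scale_left_distrib)
      qed
      show "c *u y \<in> G'" if "y \<in> G'" for c y
      proof -
        obtain g r where "y = g + r *u x" "g \<in> G" using \<open>y \<in> G'\<close> by (auto simp: G'_def)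
        then show ?thesis unfolding G'_def
          by (intro CollectI exI[of _ "c *u g"] exI[of _ "c * r"])
            (simp add: closed hom.m1.scale_right_distrib)
      qed
    qed
    moreover have "G \<subseteq> G'"
    proof
      fix y assume "y \<in> G"
      then show "y \<in> G'" unfolding G'_def by (intro CollectI exI[of _ y] exI[of _ 0]) simp
    qed
    moreover have "G' \<subseteq> S" unfolding G'_def
      using x G(3) S by (auto intro!: hom.m1.subspace_add hom.m1.subspace_scale)
    moreover have "y \<in> ?pE" if y: "y \<in> G'" "f y = of_nat p *s m" for y m
    proof -
      obtain g r where gr: "y = g + r *u x" "g \<in> G" using y(1) by (auto simp: G'_def)
      obtain a b where ab: "r = of_int a + t * b" using generated by blast
      define g' where "g' = g + b *u t *u x"
      have "t *u x \<in> G" using tS[OF x] G(2) by blast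
      then have g': "g' \<in> G"
        unfolding g'_def using hom.m1.subspace_scale[OF G(1)] by (intro closed(1) gr) blast
      have y': "y = g' + of_int a *u x"
        by (simp add: gr(1) ab g'_def hom.m1.scale_left_distrib mult.commute)
      show ?thesis
      proof (cases "int p dvd a")
        case True
        then obtain c where "a = int p * c" ..
        then have eq: "of_int a *u x = of_nat p *u of_int c *u x" by simp
        have "of_int c *u x \<in> E" using x SE by (intro hom.m1.subspace_scale[OF subspace_E]) blast
        then have "of_int a *u x \<in> G" unfolding eq using pH G(2) by blast
        then show ?thesis using G_pure[OF _ y(2)] closed(1)[OF g'] by (simp add: y')
      next
        case False
        have "prime (int p)" using prime_p by simp
        then have "coprime a (int p)" using prime_imp_coprime[OF _ False] by (simp add: coprime_commute)
        then obtain v w where vw: "v * a + w * int p = 1"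
          using bezout_int[of a "int p"] by (auto simp: coprime_iff_gcd_eq_1)
        have "f x = of_int (v * a + w * int p) *s f x" by (simp only: vw) simp
        also have "\<dots> = of_int v *s f (of_int a *u x) + of_nat p *s of_int w *s f x"
          by (simp add: scale_left_distrib hom.scale mult.commute)
        also have "of_int a *u x = y - g'" by (simp add: y')
        also have "of_int v *s f (y - g') + of_nat p *s of_int w *s f x
            = f (of_int v *u (- g')) + of_nat p *s (of_int v *s m + of_int w *s f x)"
          by (simp add: hom.diff y(2) hom.scale hom.neg scale_right_diff_distrib scale_right_distrib mult.commute)
        finally have fx: "f x = \<dots>" .
        obtain g'' where g'': "g'' \<in> G" "f g'' = of_nat p *s (of_int v *s m + of_int w *s f x)"
          using pM by blast
        then have "f x = f (of_int v *u (- g') + g'')" using fx by (simp only: hom.add)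
        moreover have "of_int v *u (- g') + g'' \<in> G" by (intro closed g' g'')
        ultimately show ?thesis using not by blast
      qed
    qed
    ultimately have "G' = G" using G(2) by (intro max) (auto simp: A_def)
    moreover have "x \<in> G'" unfolding G'_def
      using hom.m1.subspace_0[OF G(1)] by (intro CollectI exI[of _ 0] exI[of _ 1]) simp
    ultimately show False using not by blast
  qed
  then show ?thesis using G G_pure by blast
qed

text \<open>
  The submodule \<open>G\<close> is the preimage of a complement to the kernel in \<open>E / p\<close>.  It is built by descending
  induction on \<open>k\<close>: a partial section \<open>H\<close> over \<open>t ^ (k + 1) M\<close> extends to \<open>t ^ k M\<close>, because an
  element \<open>t ^ k * m\<close> has a preimage in \<open>t ^ k E\<close> whose multiple by \<open>t\<close> is the one prescribed by \<open>H\<close>.  A first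
  choice misses the prescribed value by an element that \<open>t ^ (k + 1)\<close> annihilates modulo \<open>p\<close>, and purity
  allows its correction.  The induction starts because \<open>t ^ (p ^ n)\<close> is zero modulo \<open>p\<close>.
\<close>

lemma complement_mod_p:
  "\<exists>G. hom.m1.subspace G \<and> G \<subseteq> E \<and> (*u) (of_nat p) ` E \<subseteq> G \<and> f ` G = UNIV
    \<and> (\<forall>x\<in>G. \<forall>m. f x = of_nat p *s m \<longrightarrow> x \<in> (*u) (of_nat p) ` E)"
proof -
  let ?pE = "(*u) (of_nat p) ` E"
  note E = hom.m1.subspace_add[OF subspace_E] hom.m1.subspace_scale[OF subspace_E]
    hom.m1.subspace_0[OF subspace_E] hom.m1.subspace_diff[OF subspace_E]
  define F where "F k = {t ^ k *u x + of_nat p *u e | x e. x \<in> E \<and> e \<in> E}" for k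
  have F: "hom.m1.subspace (F k)" for k
  proof (rule hom.m1.subspaceI)
    show "0 \<in> F k" unfolding F_def using E(3) by (intro CollectI exI[of _ 0]) simp
    show "y + z \<in> F k" if "y \<in> F k" "z \<in> F k" for y z
    proof -
      obtain a b where y: "y = t ^ k *u a + of_nat p *u b" "a \<in> E" "b \<in> E"
        using \<open>y \<in> F k\<close> unfolding F_def by blast
      obtain c d where z: "z = t ^ k *u c + of_nat p *u d" "c \<in> E" "d \<in> E"
        using \<open>z \<in> F k\<close> unfolding F_def by blast
      show ?thesis unfolding F_def
        by (intro CollectI exI[of _ "a + c"] exI[of _ "b + d"])
          (simp add: y z E hom.m1.scale_right_distrib)
    qed
    show "c *u y \<in> F k" if "y \<in> F k" for c y
    proof -
      obtain a b where "y = t ^ k *u a + of_nat p *u b" "a \<in> E" "b \<in> E"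
        using \<open>y \<in> F k\<close> unfolding F_def by blast
      then show ?thesis unfolding F_def
        by (intro CollectI exI[of _ "c *u a"] exI[of _ "c *u b"])
          (simp add: E hom.m1.scale_right_distrib mult.commute)
    qed
  qed
  have pF: "?pE \<subseteq> F k" for k
  proof
    fix y assume "y \<in> ?pE"
    then obtain e where "y = of_nat p *u e" "e \<in> E" by blast
    then show "y \<in> F k" unfolding F_def using E(3) by (intro CollectI exI[of _ 0] exI[of _ e]) simp
  qed
  have F_Suc: "F (Suc k) \<subseteq> F k" for k
  proof
    fix y assume "y \<in> F (Suc k)"
    then obtain x e where "y = t ^ Suc k *u x + of_nat p *u e" "x \<in> E" "e \<in> E" by (auto simp: F_def)
    then show "y \<in> F k" unfolding F_def
      by (intro CollectI exI[of _ "t *u x"] exI[of _ e]) (simp add: E mult.commute)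
  qed
  have FE: "F k \<subseteq> E" for k using E by (auto simp: F_def)
  have "\<exists>G. hom.m1.subspace G \<and> ?pE \<subseteq> G \<and> G \<subseteq> F k \<and> (\<forall>m. t ^ k *s m \<in> f ` G)
    \<and> (\<forall>x\<in>G. \<forall>m. f x = of_nat p *s m \<longrightarrow> x \<in> ?pE)" if "k \<le> p ^ n" for k
    using that
  proof (induction k rule: inc_induct)
    case base
    have sub: "hom.m1.subspace ?pE"
    proof (rule hom.m1.subspaceI)
      show "0 \<in> ?pE" using E(3) by (intro image_eqI[of _ _ 0]) simp_all
      show "x + y \<in> ?pE" if "x \<in> ?pE" "y \<in> ?pE" for x y
        using that E(1) by (auto simp flip: hom.m1.scale_right_distrib)
      show "c *u x \<in> ?pE" if x: "x \<in> ?pE" for c x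
      proof -
        obtain e where "x = of_nat p *u e" "e \<in> E" using x by blast
        then show ?thesis by (intro image_eqI[of _ _ "c *u e"]) (simp_all add: E mult.commute)
      qed
    qed
    have "t ^ (p ^ n) *s m \<in> f ` ?pE" for m
    proof -
      obtain e where e: "t ^ (p ^ n) *s m = of_nat p *s e *s m"
        using t_power_fixed[of n m] by (auto simp: augm_top)
      obtain x where "x \<in> E" "f x = e *s m" by (rule lift)
      then have "t ^ (p ^ n) *s m = f (of_nat p *u x)" by (simp only: e hom.scale)
      then show ?thesis using \<open>x \<in> E\<close> by blast
    qed
    then show ?case using sub pF by blast
  next
    case (step k)
    then obtain H where H: "hom.m1.subspace H" "?pE \<subseteq> H" "H \<subseteq> F (Suc k)"
      and Ht: "\<And>m. t ^ Suc k *s m \<in> f ` H"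
      and H_pure: "\<And>x m. x \<in> H \<Longrightarrow> f x = of_nat p *s m \<Longrightarrow> x \<in> ?pE" by blast
    define S where "S = {x \<in> F k. t *u x \<in> H}"
    have S: "hom.m1.subspace S"
      unfolding S_def using F[of k] H(1)
      by (intro hom.m1.subspaceI)
        (auto simp: hom.m1.subspace_0 hom.m1.scale_right_distrib hom.m1.subspace_add
          hom.m1.subspace_scale hom.m1.scale_left_commute[of t] simp del: hom.m1.scale_scale)
    have HS: "H \<subseteq> S"
      using H(3) F_Suc[of k] hom.m1.subspace_scale[OF H(1)] unfolding S_def by blast
    have SE: "S \<subseteq> E" using FE[of k] unfolding S_def by blast
    have tS: "t *u x \<in> H" if "x \<in> S" for x using that by (simp add: S_def)
    have "\<exists>G. hom.m1.subspace G \<and> H \<subseteq> G \<and> G \<subseteq> S \<and> f ` S \<subseteq> f ` G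
        \<and> (\<forall>x\<in>G. \<forall>m. f x = of_nat p *s m \<longrightarrow> x \<in> ?pE)"
      by (rule maximal_complement; fact)
    then obtain G where G: "hom.m1.subspace G" "H \<subseteq> G" "G \<subseteq> S" "f ` S \<subseteq> f ` G"
        "\<forall>x\<in>G. \<forall>m. f x = of_nat p *s m \<longrightarrow> x \<in> ?pE"
      by blast
    have "t ^ k *s m \<in> f ` S" for m
    proof -
      obtain y where y: "y \<in> H" "t ^ Suc k *s m = f y" using Ht by blast
      then obtain x0 e0 where xe: "y = t ^ Suc k *u x0 + of_nat p *u e0" "x0 \<in> E" "e0 \<in> E"
        using H(3) by (auto simp: F_def)
      \<comment> \<open>\<open>x0\<close> would be the preimage of \<open>m\<close> sought for, but for the error \<open>f x0 - m\<close>.\<close>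
      have "t ^ Suc k *s (f x0 - m) = of_nat p *s (- f e0)"
        by (simp only: scale_right_diff_distrib y(2) xe(1) hom.add hom.scale) simp
      then obtain x1 e1 where x1: "x1 \<in> E" "e1 \<in> E" "f x1 = f x0 - m"
          "t ^ Suc k *u x1 = of_nat p *u e1"
        using cover_pure_mod_p by blast
      let ?x = "t ^ k *u (x0 - x1)"
      have f_x: "f ?x = t ^ k *s m" by (simp add: hom.scale hom.diff x1)
      have "?x \<in> F k" unfolding F_def
        using xe x1 E by (intro CollectI exI[of _ "x0 - x1"] exI[of _ 0]) simp
      moreover have "t *u ?x \<in> H"
      proof -
        have "t *u ?x = t ^ Suc k *u x0 - t ^ Suc k *u x1"
          by (simp add: hom.m1.scale_right_diff_distrib)
        also have "\<dots> = y - of_nat p *u (e0 + e1)"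
          by (simp only: x1 xe(1) hom.m1.scale_right_distrib) simp
        also have "\<dots> \<in> H"
          using H(2) y xe x1 E by (intro hom.m1.subspace_diff[OF H(1)]) auto
        finally show ?thesis .
      qed
      ultimately have "?x \<in> S" unfolding S_def by blast
      then show ?thesis using f_x by (metis image_eqI)
    qed
    moreover have "S \<subseteq> F k" by (auto simp: S_def)
    ultimately show ?case using G H(2) by (intro exI[of _ G]) blast
  qed
  from this[of 0] obtain G where G: "hom.m1.subspace G" "?pE \<subseteq> G" "G \<subseteq> F 0" "\<forall>m. m \<in> f ` G"
      "\<forall>x\<in>G. \<forall>m. f x = of_nat p *s m \<longrightarrow> x \<in> ?pE" by auto
  then show ?thesis using FE[of 0] by (intro exI[of _ G]) auto
qed

end

text \<open>
  A complement modulo \<open>p\<close> is itself a cover of \<open>M\<close>, whose kernel is \<open>p\<close> times the old one.  As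
  multiplication by \<open>p\<close> is injective, the new kernel is isomorphic to the old one, hence again norm exact.
\<close>

lemma norm_exact_cover_iterate:
  assumes cover: "norm_exact_cover t p n s u f UNIV"
    and tf: "\<And>x. u (of_nat p) x = 0 \<Longrightarrow> x = 0"
  shows "\<exists>E. norm_exact_cover t p n s u f E
    \<and> {x \<in> E. f x = 0} = u (of_nat (p ^ k)) ` {x. f x = 0}"
proof (induction k)
  case 0
  interpret norm_exact_cover t p n s u f UNIV by fact
  show ?case using cover by (intro exI[of _ UNIV]) auto
next
  case (Suc k)
  interpret P: norm_exact_cover t p n s u f UNIV by fact
  obtain E where E: "norm_exact_cover t p n s u f E"
    and ker: "{x \<in> E. f x = 0} = u (of_nat (p ^ k)) ` {x. f x = 0}"
    using Suc.IH by blast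
  interpret E: norm_exact_cover t p n s u f E by fact
  obtain G where G: "P.hom.m1.subspace G" "u (of_nat p) ` E \<subseteq> G" "f ` G = UNIV"
      "\<forall>x\<in>G. \<forall>m. f x = s (of_nat p) m \<longrightarrow> x \<in> u (of_nat p) ` E"
    using E.complement_mod_p by blast
  have tfk: "x = 0" if "u (of_nat (p ^ l)) x = 0" for l x
    using that by (induction l) (auto simp: tf simp flip: P.hom.m1.scale_scale)
  have kerG: "{x \<in> G. f x = 0} = u (of_nat (p ^ Suc k)) ` {x. f x = 0}"
  proof (intro subset_antisym subsetI)
    fix x assume x: "x \<in> {x \<in> G. f x = 0}"
    then have "f x = s (of_nat p) 0" by simp
    then obtain e where e: "e \<in> E" "x = u (of_nat p) e" using G(4) x by blast
    then have "f e = 0" using x P.torsion_free by (auto simp: P.hom.scale)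
    then obtain y where "f y = 0" "e = u (of_nat (p ^ k)) y" using e ker by blast
    then show "x \<in> u (of_nat (p ^ Suc k)) ` {x. f x = 0}" using e by auto
  next
    fix x assume "x \<in> u (of_nat (p ^ Suc k)) ` {x. f x = 0}"
    then obtain y where y: "f y = 0" "x = u (of_nat p) (u (of_nat (p ^ k)) y)" by auto
    then have "u (of_nat (p ^ k)) y \<in> E" using ker by blast
    then show "x \<in> {x \<in> G. f x = 0}" using G(2) y by (auto simp: P.hom.scale)
  qed
  have "norm_exact_cover t p n s u f G"
  proof unfold_locales
    fix j x assume j: "j \<le> n" and x: "x \<in> G" "f x = 0" "u (P.full_norm j) x = 0"
    then obtain y where y: "f y = 0" "x = u (of_nat (p ^ Suc k)) y" using kerG by blast
    have "u (of_nat (p ^ Suc k)) (u (P.full_norm j) y) = 0"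
      using x(3) unfolding y by (metis P.hom.m1.scale_left_commute)
    then have "u (P.full_norm j) y = 0" by (rule tfk)
    then obtain z where z: "f z = 0" "y = u (P.augm j) z" using P.kernel_norm_exact[OF j, of y] y by auto
    have "x = u (P.augm j) (u (of_nat (p ^ Suc k)) z)"
      unfolding y(2) z(2) by (rule P.hom.m1.scale_left_commute)
    moreover have "u (of_nat (p ^ Suc k)) z \<in> {x \<in> G. f x = 0}" using kerG z by blast
    ultimately show "\<exists>y\<in>G. f y = 0 \<and> x = u (P.augm j) y" by blast
  qed (use G in auto)
  then show ?case using kerG by blast
qed

section \<open>Averaging a \<open>\<int>\<close>-linear section\<close>

lemma int_scale_of_nat: "int_scale s (int k) x = s (of_nat k) x"
  by (simp add: int_scale_def)

lemma int_basis_torsion_free: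
  assumes s: "module s" and B: "int_basis s B" and k: "k > 0" and x: "s (of_nat k) x = 0"
  shows "x = 0"
proof -
  interpret i: module "int_scale s" using s by (rule module_int_scale)
  have B': "i.independent B" "\<And>x. x \<in> i.span B" using B by (auto simp: int_basis_def)
  have "i.representation B (int_scale s (int k) x) = (\<lambda>b. int k * i.representation B x b)"
    using B' by (intro i.representation_scale) auto
  then have "i.representation B x b = 0" for b
    using x k by (simp add: int_scale_of_nat i.representation_zero fun_eq_iff)
  then have "{b. i.representation B x b \<noteq> 0} = {}" by simp
  then show ?thesis using i.sum_nonzero_representation_eq[OF B', of x] by simp
qed

lemma additive_section_into_submodule:
  assumes hom: "module_hom u s f" and B: "int_basis s B"
    and E: "module.subspace u E" "f ` E = UNIV"
  shows "\<exists>sec. (\<forall>x y. sec (x + y) = sec x + sec y) \<and> (\<forall>m. sec m \<in> E \<and> f (sec m) = m)"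
proof -
  interpret f: module_hom u s f by fact
  interpret i: module "int_scale s" by (rule module_int_scale) unfold_locales
  interpret j: module "int_scale u" by (rule module_int_scale) unfold_locales
  have B': "i.independent B" "\<And>x. x \<in> i.span B" using B by (auto simp: int_basis_def)
  define R where "R = i.representation B"
  have R: "finite {b. R v b \<noteq> 0}" "(\<Sum>b | R v b \<noteq> 0. int_scale s (R v b) b) = v" for v
    unfolding R_def
    by (auto intro: i.finite_representation i.sum_nonzero_representation_eq[OF B'])
  have R_add: "R (x + y) b = R x b + R y b" for x y b
    using B' by (simp add: R_def i.representation_add)
  have "\<forall>m. \<exists>x\<in>E. f x = m" using E(2) by (metis UNIV_I imageE)
  then obtain e where e: "\<And>m. e m \<in> E" "\<And>m. f (e m) = m" by metis
  define sec where "sec m = (\<Sum>b | R m b \<noteq> 0. int_scale u (R m b) (e b))" for m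
  have sec: "sec m = (\<Sum>b\<in>S. int_scale u (R m b) (e b))"
    if "finite S" "{b. R m b \<noteq> 0} \<subseteq> S" for m S
    unfolding sec_def using that by (intro sum.mono_neutral_left) auto
  have "sec (x + y) = sec x + sec y" for x y
  proof -
    let ?S = "{b. R x b \<noteq> 0} \<union> {b. R y b \<noteq> 0}"
    have "finite ?S" using R by simp
    then show ?thesis
      by (subst (1 2 3) sec[of ?S]) (auto simp: R_add j.scale_left_distrib sum.distrib)
  qed
  moreover have "sec m \<in> E" for m
    unfolding sec_def int_scale_def by (intro f.m1.subspace_sum f.m1.subspace_scale E e)
  moreover have "f (sec m) = m" for m
  proof -
    have "f (sec m) = (\<Sum>b | R m b \<noteq> 0. int_scale s (R m b) b)"
      unfolding sec_def by (simp add: f.sum int_scale_def f.scale e)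
    then show ?thesis by (simp add: R)
  qed
  ultimately show ?thesis by blast
qed

text \<open>
  A \<open>\<int>\<close>-linear section \<open>sec\<close> into \<open>E\<close> differs from each of its conjugates by an element of the kernel, which is
  divisible by the order \<open>Q\<close> of the group.  The sum of all conjugates is therefore not only
  equivariant and a lift of \<open>Q * m\<close> but divisible by \<open>Q\<close>, and its quotient by \<open>Q\<close> is an equivariant section.
\<close>

lemma averaged_section:
  fixes u :: "('g::ab_group_add \<Rightarrow>\<^sub>0 int) \<Rightarrow> 'e::ab_group_add \<Rightarrow> 'e"
    and s :: "('g \<Rightarrow>\<^sub>0 int) \<Rightarrow> 'm::ab_group_add \<Rightarrow> 'm"
  assumes hom: "module_hom u s f" and B: "int_basis s B" and Q: "card (UNIV :: 'g set) = Q" "Q > 0"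
    and E: "module.subspace u E" "f ` E = UNIV"
    and ker: "\<And>x. x \<in> E \<Longrightarrow> f x = 0 \<Longrightarrow> \<exists>y. x = u (of_nat Q) y"
    and tf: "\<And>x. u (of_nat Q) x = 0 \<Longrightarrow> x = 0"
  shows "\<exists>h. module_hom s u h \<and> (\<forall>m. f (h m) = m)"
proof -
  interpret f: module_hom u s f by fact
  have fin: "finite (UNIV :: 'g set)" using Q by (intro card_ge_0_finite) simp
  have tfs: "m = 0" if "s (of_nat Q) m = 0" for m
    using int_basis_torsion_free[OF f.m2.module_axioms B Q(2) that] .
  obtain sec where sec_add: "\<And>x y. sec (x + y) = sec x + sec y"
    and sec: "\<And>m. sec m \<in> E" "\<And>m. f (sec m) = m"
    using additive_section_into_submodule[OF hom B E] by blast
  have act_add: "act s (g + h) x = act s g (act s h x)" "act u (g + h) y = act u g (act u h y)" for g h x y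
    by (simp_all add: act_def mult_single)
  have act_0: "act s 0 x = x" for x by (simp add: act_def)
  define S where "S m = (\<Sum>g\<in>UNIV. act u g (sec (act s (- g) m)))" for m
  have term_E: "act u g (sec (act s (- g) m)) \<in> E" for g m
    unfolding act_def[of u] by (intro f.m1.subspace_scale E sec)
  have f_term: "f (act u g (sec (act s (- g) m))) = m" for g m
  proof -
    have "f (act u g (sec (act s (- g) m))) = act s g (act s (- g) m)"
      by (simp only: act_def f.scale sec)
    then show ?thesis by (simp add: act_0 flip: act_add)
  qed
  have "\<exists>x. S m = u (of_nat Q) x" for m
  proof -
    have "\<exists>y. act u g (sec (act s (- g) m)) - sec m = u (of_nat Q) y" for g
      by (intro ker f.m1.subspace_diff E term_E sec) (simp add: f.diff f_term sec)
    then obtain d where d: "\<And>g. act u g (sec (act s (- g) m)) - sec m = u (of_nat Q) (d g)" by metis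
    have "S m = (\<Sum>g\<in>(UNIV :: 'g set). sec m + u (of_nat Q) (d g))"
      unfolding S_def by (intro sum.cong refl) (simp flip: d)
    also have "(\<Sum>g\<in>(UNIV :: 'g set). sec m) = u (of_nat Q) (sec m)"
    proof -
      have "(\<Sum>g\<in>A. sec m) = u (of_nat (card A)) (sec m)" if "finite A" for A :: "'g set"
        using that by induction (simp_all add: f.m1.scale_left_distrib)
      then show ?thesis using fin Q by blast
    qed
    then have "(\<Sum>g\<in>(UNIV :: 'g set). sec m + u (of_nat Q) (d g))
        = u (of_nat Q) (sec m + (\<Sum>g\<in>UNIV. d g))"
      by (simp add: sum.distrib f.m1.scale_right_distrib f.m1.scale_sum_right)
    finally show ?thesis by blast
  qed
  then obtain h where h: "\<And>m. S m = u (of_nat Q) (h m)" by metis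
  have h_eqI: "h m = x" if "S m = u (of_nat Q) x" for m x
    using tf[of "h m - x"] that h[of m] by (simp add: f.m1.scale_right_diff_distrib)
  have "module_hom s u h"
  proof (rule module_homI_act)
    show "h (x + y) = h x + h y" for x y
    proof (rule h_eqI)
      have "S (x + y) = S x + S y"
        by (simp add: S_def act_def f.m1.scale_right_distrib f.m2.scale_right_distrib sec_add sum.distrib)
      then show "S (x + y) = u (of_nat Q) (h x + h y)" by (simp add: h f.m1.scale_right_distrib)
    qed
    show "h (act s g m) = act u g (h m)" for g m
    proof (rule h_eqI)
      have "S (act s g m) = (\<Sum>k\<in>UNIV. act u (g + k) (sec (act s (- (g + k)) (act s g m))))"
        unfolding S_def by (rule sum.reindex_bij_witness[of _ "\<lambda>k. g + k" "\<lambda>k. k - g"]) auto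
      also have "\<dots> = (\<Sum>k\<in>UNIV. act u g (act u k (sec (act s (- k) m))))"
        by (simp add: act_add[symmetric])
      also have "\<dots> = act u g (S m)" by (simp add: S_def act_def f.m1.scale_sum_right)
      also have "\<dots> = u (of_nat Q) (act u g (h m))" by (simp add: h act_def mult.commute)
      finally show "S (act s g m) = u (of_nat Q) (act u g (h m))" .
    qed
  qed unfold_locales
  moreover have "f (h m) = m" for m
  proof -
    have "s (of_nat Q) (f (h m)) = f (S m)" by (simp add: h f.scale)
    also have "\<dots> = (\<Sum>g\<in>(UNIV :: 'g set). m)" by (simp add: S_def f.sum f_term)
    also have "\<dots> = s (of_nat Q) m"
    proof -
      have "(\<Sum>g\<in>A. m) = s (of_nat (card A)) m" if "finite A" for A :: "'g set"
        using that by induction (simp_all add: f.m2.scale_left_distrib)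
      then show ?thesis using fin Q by blast
    qed
    finally have "s (of_nat Q) (f (h m) - m) = 0" by (simp add: f.m2.scale_right_diff_distrib)
    then show ?thesis using tfs by fastforce
  qed
  ultimately show ?thesis by blast
qed

section \<open>Multiples in a cyclic group\<close>

definition nmul :: "nat \<Rightarrow> 'g::ab_group_add \<Rightarrow> 'g" where
  "nmul k g = (\<Sum>i<k. g)"

lemma nmul_simps [simp]: "nmul 0 g = 0" "nmul (Suc k) g = nmul k g + g"
  by (simp_all add: nmul_def)

lemma nmul_add: "nmul (k + l) g = nmul k g + nmul l g"
  by (induction l) (simp_all add: add.assoc)

lemma nmul_zero [simp]: "nmul k 0 = 0"
  by (induction k) simp_all

lemma nmul_mult: "nmul (k * l) g = nmul k (nmul l g)"
  by (induction k) (simp_all add: nmul_add add.commute)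

lemma single_power: "Poly_Mapping.single g (1::int) ^ k = Poly_Mapping.single (nmul k g) 1"
  by (induction k) (simp_all add: mult_single add.commute)

lemma cyclic_group_multiples:
  fixes g :: "'g::ab_group_add"
  assumes gen: "group_closure {g} = UNIV" and card: "card (UNIV :: 'g set) = Q" "Q > 0"
  shows "(\<exists>k. x = nmul k g) \<and> (nmul k g = 0 \<longleftrightarrow> Q dvd k)"
proof -
  have fin: "finite (UNIV :: 'g set)" using card by (intro card_ge_0_finite) simp
  have diff: "nmul (b - a) g = 0" if "nmul a g = nmul b g" "a \<le> b" for a b
    using that nmul_add[of a "b - a" g] by simp
  have "\<not> inj (\<lambda>k. nmul k g)"
    using finite_imageD[of "\<lambda>k. nmul k g" UNIV] finite_subset[OF subset_UNIV fin] by auto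
  then obtain a b where "nmul a g = nmul b g" "a < b" by (metis injI linorder_neqE_nat)
  then have ex: "\<exists>k>0. nmul k g = 0" using diff[of a b] by (intro exI[of _ "b - a"]) auto
  define m where "m = (LEAST k. k > 0 \<and> nmul k g = 0)"
  have m: "m > 0" "nmul m g = 0" using LeastI_ex[OF ex] by (auto simp: m_def)
  have m_min: "m \<le> k" if "k > 0" "nmul k g = 0" for k
    unfolding m_def using that by (intro Least_le) simp
  have mod: "nmul k g = nmul (k mod m) g" for k
    using nmul_add[of "k div m * m" "k mod m" g] by (simp add: nmul_mult m)
  have neg: "- nmul k g = nmul ((m - 1) * k) g" for k
  proof -
    have "nmul k g + nmul ((m - 1) * k) g = nmul (k * m) g"
      using m(1) by (cases m) (simp_all add: nmul_add[symmetric] mult.commute)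
    then show ?thesis by (simp add: nmul_mult m minus_unique)
  qed
  have "x \<in> range (\<lambda>k. nmul k g)" if "x \<in> group_closure {g}" for x
    using that
  proof induction
    case (base x)
    then show ?case by (auto intro: range_eqI[of _ _ 0] range_eqI[of _ _ 1])
  next
    case (diff x y)
    then obtain k l where "x = nmul k g" "y = nmul l g" by auto
    then have "x - y = nmul (k + (m - 1) * l) g" by (simp only: nmul_add neg[symmetric]) simp
    then show ?case by blast
  qed
  then have surj: "\<exists>k. x = nmul k g" for x using gen by blast
  have "bij_betw (\<lambda>k. nmul k g) {..<m} UNIV"
  proof (rule bij_betw_imageI)
    show "inj_on (\<lambda>k. nmul k g) {..<m}"
    proof (rule linorder_inj_onI)
      fix a b assume "a < b" "a \<in> {..<m}" "b \<in> {..<m}"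
      then show "nmul a g \<noteq> nmul b g" using diff[of a b] m_min[of "b - a"] by auto
    qed auto
    show "(\<lambda>k. nmul k g) ` {..<m} = UNIV"
    proof (intro equalityI subsetI UNIV_I)
      fix x
      obtain k where "x = nmul (k mod m) g" using surj[of x] mod by metis
      then show "x \<in> (\<lambda>k. nmul k g) ` {..<m}" using m(1) by simp
    qed
  qed
  then have "m = Q" using card by (simp add: bij_betw_same_card[symmetric])
  moreover have "nmul k g = 0 \<longleftrightarrow> m dvd k"
    using mod[of k] m_min[of "k mod m"] m(1)
    by (metis dvd_imp_mod_0 mod_greater_zero_iff_not_dvd mod_less_divisor nmul_simps(1) not_less)
  ultimately show ?thesis using surj by simp
qed

lemma group_ring_generated:
  fixes g :: "'g::ab_group_add" and r :: "'g \<Rightarrow>\<^sub>0 int"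
  assumes "\<And>x. \<exists>k. x = nmul k g"
  shows "\<exists>a b. r = of_int a + (Poly_Mapping.single g 1 - 1) * b"
  using subset_UNIV[of "Poly_Mapping.keys r"]
proof (induction r rule: frag_induction)
  case zero
  show ?case by (intro exI[of _ 0]) simp
next
  case (one x)
  obtain k where "x = nmul k g" using assms by blast
  then have "Poly_Mapping.single g 1 - 1 dvd Poly_Mapping.single x (1::int) - 1"
    using dvd_power_difference[of "Poly_Mapping.single g (1::int)" 1 k] by (simp add: single_power)
  then obtain b where "Poly_Mapping.single x (1::int) - 1 = (Poly_Mapping.single g 1 - 1) * b" ..
  then have "Poly_Mapping.single x (1::int) = of_int 1 + (Poly_Mapping.single g 1 - 1) * b"
    by (simp add: diff_eq_eq add.commute)
  then show ?case by blast
next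
  case (diff x y)
  then obtain a b a' b' where "x = of_int a + (Poly_Mapping.single g 1 - 1) * b"
      "y = of_int a' + (Poly_Mapping.single g 1 - 1) * b'" by blast
  then have "x - y = of_int (a - a') + (Poly_Mapping.single g 1 - 1) * (b - b')"
    by (simp add: right_diff_distrib)
  then show ?case by blast
qed

section \<open>Norm exactness of permutation modules and of coflasque modules\<close>

text \<open>
  Let \<open>\<phi>\<close> replace every basis element by a representative of its orbit under \<open>h\<close>.  It changes elements only
  by multiples of \<open>h - 1\<close>, and it is invariant under \<open>h\<close>, so that it sends the norm of \<open>x\<close> to
  \<open>w\<close> times \<open>\<phi> x\<close>.  If the norm vanishes, then so does \<open>\<phi> x\<close>.
\<close>

lemma permutation_norm_exact:
  fixes a :: "'g::ab_group_add \<Rightarrow> 'x \<Rightarrow> 'x"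
  assumes a0: "\<And>y. a 0 y = y" and a_add: "\<And>g h y. a (g + h) y = a g (a h y)"
    and w: "w > 0" "nmul w h = 0"
    and x: "perm_scale a (\<Sum>l<w. Poly_Mapping.single h 1 ^ l) x = 0"
  shows "\<exists>y. x = perm_scale a (Poly_Mapping.single h 1 - 1) y"
proof -
  interpret P: module "perm_scale a" by (rule module_perm_scale) fact+
  let ?X = "Poly_Mapping.single h (1::int)"
  define rep where "rep y = (SOME z. \<exists>l. z = a (nmul l h) y)" for y
  have rep: "\<exists>l. rep y = a (nmul l h) y" for y
    unfolding rep_def by (rule someI_ex) blast
  have rep_h: "rep (a h y) = rep y" for y
  proof -
    have "(\<exists>l. z = a (nmul l h) (a h y)) \<longleftrightarrow> (\<exists>l. z = a (nmul l h) y)" for z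
    proof
      assume "\<exists>l. z = a (nmul l h) (a h y)"
      then show "\<exists>l. z = a (nmul l h) y" by (metis a_add nmul_simps(2))
    next
      assume "\<exists>l. z = a (nmul l h) y"
      then obtain l where "z = a (nmul l h) y" ..
      moreover have "nmul (l + (w - 1)) h + h = nmul l h"
        using w nmul_add[of l w h] nmul_simps(2)[of "l + (w - 1)" h] by (simp del: nmul_simps)
      ultimately show "\<exists>l. z = a (nmul l h) (a h y)" by (metis a_add)
    qed
    then show ?thesis by (simp add: rep_def)
  qed
  define \<phi> where "\<phi> = frag_extend (\<lambda>y. frag_of (rep y))"
  have \<phi>_h: "\<phi> (perm_scale a ?X z) = \<phi> z" for z
    unfolding act_def[symmetric] act_perm_scale using subset_UNIV[of "Poly_Mapping.keys z"]
    by (induction z rule: frag_induction) (simp_all add: \<phi>_def rep_h frag_extend_diff)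
  have \<phi>_power: "\<phi> (perm_scale a (?X ^ l) z) = \<phi> z" for l z
    by (induction l) (simp_all add: \<phi>_h flip: P.scale_scale)
  have \<phi>_add: "\<phi> (y + z) = \<phi> y + \<phi> z" and \<phi>_0: "\<phi> 0 = 0" for y z
    by (simp_all add: \<phi>_def frag_extend_add)
  have "\<phi> (perm_scale a (\<Sum>l<k. ?X ^ l) z) = frag_cmul (int k) (\<phi> z)" for k z
    by (induction k)
      (simp_all add: \<phi>_0 \<phi>_add \<phi>_power P.scale_left_distrib frag_cmul_distrib add.commute)
  then have "frag_cmul (int w) (\<phi> x) = 0" using x \<phi>_0 by metis
  then have "\<phi> x = 0" using w(1) by (simp add: poly_mapping_eq_iff fun_eq_iff)
  moreover have "\<exists>y. z - \<phi> z = perm_scale a (?X - 1) y" for z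
    using subset_UNIV[of "Poly_Mapping.keys z"]
  proof (induction z rule: frag_induction)
    case zero
    show ?case by (intro exI[of _ 0]) (simp add: \<phi>_0)
  next
    case (one y)
    obtain l where l: "rep y = a (nmul l h) y" using rep by blast
    obtain c where c: "?X ^ l - 1 = (?X - 1) * c"
      using dvd_power_difference[of ?X 1 l] by (auto elim: dvdE)
    have "frag_of y - \<phi> (frag_of y) = perm_scale a (- (?X ^ l - 1)) (frag_of y)"
      by (simp add: P.scale_left_diff_distrib \<phi>_def l single_power)
        (simp add: perm_scale_def)
    also have "\<dots> = perm_scale a (?X - 1) (perm_scale a (- c) (frag_of y))" by (simp add: c)
    finally show ?case by blast
  next
    case (diff y z)
    then obtain y' z' where "y - \<phi> y = perm_scale a (?X - 1) y'" "z - \<phi> z = perm_scale a (?X - 1) z'"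
      by blast
    moreover have "(y - z) - \<phi> (y - z) = (y - \<phi> y) - (z - \<phi> z)"
      by (simp add: \<phi>_def frag_extend_diff)
    ultimately have "(y - z) - \<phi> (y - z) = perm_scale a (?X - 1) (y' - z')"
      by (simp only: P.scale_right_diff_distrib)
    then show ?case by blast
  qed
  ultimately show ?thesis by (metis diff_zero)
qed

text \<open>
  The cocycle sends \<open>k\<close> times \<open>h\<close> to \<open>(1 + h + \<dots> + h ^ (k - 1)) m\<close>, which depends only on \<open>k\<close> modulo
  \<open>w\<close> because the norm of \<open>m\<close> is zero.
\<close>

lemma cocycle_from_norm_zero:
  fixes s :: "('g::ab_group_add \<Rightarrow>\<^sub>0 int) \<Rightarrow> 'm::ab_group_add \<Rightarrow> 'm" and h :: 'g
  assumes s: "module s" and w: "w > 0" and h: "\<And>k. nmul k h = 0 \<longleftrightarrow> w dvd k"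
    and H: "H = range (\<lambda>k. nmul k h)"
    and m: "s (\<Sum>l<w. Poly_Mapping.single h 1 ^ l) m = 0"
  shows "\<exists>c \<in> cocycles1 s H. c h = m"
proof -
  interpret module s by fact
  let ?X = "Poly_Mapping.single h (1::int)"
  define F where "F k = s (\<Sum>i<k. ?X ^ i) m" for k
  have F_add: "F (k + l) = F k + s (?X ^ k) (F l)" for k l
  proof -
    have "(\<Sum>i<k + l. ?X ^ i) = (\<Sum>i<k. ?X ^ i) + ?X ^ k * (\<Sum>i<l. ?X ^ i)"
      by (induction l) (simp_all add: algebra_simps power_add)
    then show ?thesis by (simp add: F_def scale_left_distrib)
  qed
  have Xw: "?X ^ w = 1" using h[of w] by (simp add: single_power)
  have "F w = 0" using m by (simp add: F_def)
  then have F_w: "F (w * c) = 0" for c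
    by (induction c) (simp_all add: F_add Xw F_def[of 0])
  have F_cong: "F k = F l" if "nmul k h = nmul l h" "k \<le> l" for k l
  proof -
    have "nmul (l - k) h = 0" using that nmul_add[of k "l - k" h] by simp
    then obtain c where "l - k = w * c" using h by (auto elim: dvdE)
    then have "l = w * c + k" using that by simp
    then show ?thesis by (simp add: F_add F_w power_mult Xw)
  qed
  have F_cong': "F k = F l" if "nmul k h = nmul l h" for k l
    using F_cong[of k l] F_cong[of l k] that by (metis nat_le_linear)
  define dl where "dl x = (SOME k. nmul k h = x)" for x
  have dl: "nmul (dl (nmul k h)) h = nmul k h" for k
    unfolding dl_def by (rule someI_ex) blast
  define c where "c = restrict (\<lambda>x. F (dl x)) H"
  have c: "c (nmul k h) = F k" for k
    using F_cong'[OF dl] by (simp add: c_def H)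
  have "c \<in> cocycles1 s H"
    unfolding cocycles1_def H
  proof (intro CollectI conjI ballI)
    show "c \<in> extensional (range (\<lambda>k. nmul k h))" by (simp add: c_def H)
    fix x y assume "x \<in> range (\<lambda>k. nmul k h)" "y \<in> range (\<lambda>k. nmul k h)"
    then obtain k l where "x = nmul k h" "y = nmul l h" by blast
    then show "c (x + y) = c x + act s x (c y)"
      by (simp add: c F_add act_def single_power flip: nmul_add)
  qed
  moreover have "c h = m" using c[of 1] by (simp add: F_def)
  ultimately show ?thesis by blast
qed

lemma coflasque_norm_exact:
  fixes s :: "('g::ab_group_add \<Rightarrow>\<^sub>0 int) \<Rightarrow> 'm::ab_group_add \<Rightarrow> 'm" and h :: 'g
  assumes cof: "coflasque s" and w: "w > 0" and h: "\<And>k. nmul k h = 0 \<longleftrightarrow> w dvd k"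
    and m: "s (\<Sum>l<w. Poly_Mapping.single h 1 ^ l) m = 0"
  shows "\<exists>y. m = s (Poly_Mapping.single h 1 - 1) y"
proof -
  have s: "module s" using cof by (simp add: coflasque_def)
  interpret module s by fact
  define H where "H = range (\<lambda>k. nmul k h)"
  have w0: "nmul w h = 0" using h by simp
  have "is_subgroup H"
    unfolding is_subgroup_def
  proof (intro conjI ballI)
    show "0 \<in> H" unfolding H_def by (rule range_eqI[of _ _ 0]) simp
    show "x + y \<in> H" if "x \<in> H" "y \<in> H" for x y
      using that unfolding H_def by (auto simp flip: nmul_add)
    show "- x \<in> H" if x: "x \<in> H" for x
    proof -
      obtain k where k: "x = nmul k h" using x by (auto simp: H_def)
      have "nmul k h + nmul ((w - 1) * k) h = nmul (k * w) h"
        using w by (cases w) (simp_all add: nmul_add[symmetric] mult.commute)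
      then have "- x = nmul ((w - 1) * k) h" by (simp add: k nmul_mult w0 minus_unique)
      then show ?thesis unfolding H_def by blast
    qed
  qed
  then have "cocycles1 s H \<subseteq> coboundaries1 s H"
    using cof cohomology1_trivial_iff[OF s] by (simp add: coflasque_def)
  moreover obtain c where c: "c \<in> cocycles1 s H" "c h = m"
    using cocycle_from_norm_zero[OF s w h H_def m] by blast
  ultimately obtain y where "c = restrict (\<lambda>g. act s g y - y) H"
    unfolding coboundaries1_def by blast
  moreover have "h \<in> H" unfolding H_def by (rule range_eqI[of _ _ 1]) simp
  ultimately have "m = s (Poly_Mapping.single h 1 - 1) y"
    using c(2) by (simp add: act_def scale_left_diff_distrib)
  then show ?thesis by blast
qed

text \<open>
  The module itself serves as the permuted basis: the free abelian group on the set \<open>M\<close> is a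
  permutation module that maps onto \<open>M\<close>, and every fixed point \<open>m\<close> of a subgroup is the image of the basis element
  of \<open>m\<close>, which the same subgroup fixes.
\<close>

lemma evaluation_module_hom:
  fixes s :: "('g::ab_group_add \<Rightarrow>\<^sub>0 int) \<Rightarrow> 'm::ab_group_add \<Rightarrow> 'm"
  assumes s: "module s"
  shows "\<exists>f. module_hom (perm_scale (act s)) s f \<and> (\<forall>m. f (frag_of m) = m)"
proof -
  interpret module s by fact
  interpret i: module "int_scale s" by (rule module_int_scale) fact
  have act: "act s 0 x = x" "act s (g + h) x = act s g (act s h x)" for g h x
    by (simp_all add: act_def mult_single)
  define f where "f x = (\<Sum>y\<in>Poly_Mapping.keys x. int_scale s (Poly_Mapping.lookup x y) y)" for x :: "'m \<Rightarrow>\<^sub>0 int"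
  have f_sup: "f x = (\<Sum>y\<in>S. int_scale s (Poly_Mapping.lookup x y) y)"
    if "finite S" "Poly_Mapping.keys x \<subseteq> S" for x S
    unfolding f_def using that by (intro sum.mono_neutral_left) (auto simp: in_keys_iff)
  have f_add: "f (x + y) = f x + f y" for x y
    using keys_add[of x y]
    by (simp add: f_sup[of "Poly_Mapping.keys x \<union> Poly_Mapping.keys y"] lookup_add
        i.scale_left_distrib sum.distrib)
  interpret f: additive f by unfold_locales (rule f_add)
  have f_of: "f (frag_of y) = y" for y by (simp add: f_def)
  have "module_hom (perm_scale (act s)) s f"
  proof (rule module_homI_act[OF module_perm_scale[OF act] s f_add])
    show "f (act (perm_scale (act s)) g x) = act s g (f x)" for g x
      using subset_UNIV[of "Poly_Mapping.keys x"]
    proof (induction x rule: frag_induction)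
      case zero then show ?case by (simp add: f.zero act_perm_scale) (simp add: act_def)
    next
      case (one y) then show ?case by (simp add: f_of act_perm_scale)
    next
      case (diff x y)
      then show ?case
        by (simp add: act_perm_scale frag_extend_diff f.diff) (simp add: act_def scale_right_diff_distrib)
    qed
  qed
  then show ?thesis using f_of by blast
qed

section \<open>Coflasque modules are permutation projective\<close>

theorem theorem1p6:
  fixes s :: "('g::ab_group_add \<Rightarrow>\<^sub>0 int) \<Rightarrow> 'm::ab_group_add \<Rightarrow> 'm"
    and p n :: nat
  assumes "prime p"
    and "\<exists>g :: 'g. group_closure {g} = UNIV"
    and "card (UNIV :: 'g set) = p ^ n"
    and "coflasque s"
  shows "permutation_projective s"
proof -
  obtain g :: 'g where g: "group_closure {g} = UNIV" using assms(2) by blast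
  have p: "p > 0" using assms(1) by (rule prime_gt_0_nat)
  then have Q: "p ^ n > 0" by simp
  note cyclic = cyclic_group_multiples[OF g assms(3) Q]
  obtain B where s: "module s" and B: "int_basis s B" using assms(4) by (auto simp: coflasque_def)
  interpret s: module s by fact
  define t where "t = Poly_Mapping.single g (1::int) - 1"
  have t1: "1 + t = Poly_Mapping.single g 1" by (simp add: t_def)
  interpret cyclic_p_ring t p n
  proof
    show "prime p" by fact
    show "(1 + t) ^ (p ^ n) = 1"
      using cyclic[of 0 "p ^ n"] by (simp add: t1 single_power)
    show "\<exists>a b. r = of_int a + t * b" for r
      unfolding t_def using cyclic by (intro group_ring_generated) blast
  qed
  have augm: "augm j = Poly_Mapping.single (nmul (p ^ j) g) 1 - 1" for j
    by (simp add: augm_def t1 single_power)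
  have full_norm: "full_norm j = (\<Sum>l<p ^ (n - j). Poly_Mapping.single (nmul (p ^ j) g) 1 ^ l)" for j
    by (simp add: full_norm_def t1 power_mult single_power)
  have order: "nmul k (nmul (p ^ j) g) = 0 \<longleftrightarrow> p ^ (n - j) dvd k" if "j \<le> n" for j k
  proof -
    have "p ^ n = p ^ (n - j) * p ^ j" using that by (simp flip: power_add)
    then show ?thesis using cyclic[of 0 "k * p ^ j"] p by (simp add: nmul_mult)
  qed
  interpret M: norm_exact_lattice t p n s
  proof
    show "x = 0" if "s (of_nat p) x = 0" for x
      using int_basis_torsion_free[OF s B p that] .
    show "\<exists>y. x = s (augm j) y" if j: "j \<le> n" and x: "s (full_norm j) x = 0" for j x
      unfolding augm
      using x p by (intro coflasque_norm_exact[OF assms(4) _ order[OF j]]) (simp_all add: full_norm)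
  qed
  let ?u = "perm_scale (act s)"
  have act: "act s 0 x = x" "act s (g + h) x = act s g (act s h x)" for g h x
    by (simp_all add: act_def mult_single)
  have perm: "permutation_module ?u" by (rule permutation_module_perm_scale) (fact act)+
  obtain f where f: "module_hom ?u s f" and f_of: "\<And>m. f (frag_of m) = m"
    using evaluation_module_hom[OF s] by blast
  interpret f: module_hom ?u s f by fact
  have scale_nat: "?u (of_nat k) x = frag_cmul (int k) x" for k x
    using int_scale_perm_scale[of "act s" "int k" x] act(1) by (simp add: int_scale_of_nat)
  have tf: "x = 0" if "?u (of_nat k) x = 0" "k > 0" for k x
    using that by (simp add: scale_nat poly_mapping_eq_iff fun_eq_iff)
  have cover: "norm_exact_cover t p n s ?u f UNIV"
  proof unfold_locales
    show "f.m1.subspace UNIV" by (rule f.m1.subspace_UNIV)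
    show "f ` UNIV = UNIV" by (rule surjI) (rule f_of)
    fix j x assume j: "j \<le> n" and x: "f x = 0" "?u (full_norm j) x = 0"
    have "\<exists>y. x = ?u (augm j) y" unfolding augm
    proof (rule permutation_norm_exact)
      show "nmul (p ^ (n - j)) (nmul (p ^ j) g) = 0" using order[OF j] by simp
      show "?u (\<Sum>l<p ^ (n - j). Poly_Mapping.single (nmul (p ^ j) g) 1 ^ l) x = 0"
        using x(2) by (simp only: full_norm)
      show "0 < p ^ (n - j)" using p by simp
    qed (fact act)+
    then obtain y where y: "x = ?u (augm j) y" ..
    \<comment> \<open>\<open>y\<close> need not lie in the kernel, but \<open>f y\<close> is fixed, and subtracting its basis element corrects this.\<close>
    have "s (augm j) (f y) = 0" using x(1) by (simp add: y f.scale)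
    then have "act s (nmul (p ^ j) g) (f y) = f y"
      by (simp add: augm act_def s.scale_left_diff_distrib)
    then have "?u (augm j) (frag_of (f y)) = 0"
      using act_perm_scale[of "act s" "nmul (p ^ j) g" "frag_of (f y)"]
      by (simp add: augm f.m1.scale_left_distrib f.m1.scale_left_diff_distrib act_def[of ?u])
    then have "x = ?u (augm j) (y - frag_of (f y))" by (simp add: y f.m1.scale_right_diff_distrib)
    moreover have "f (y - frag_of (f y)) = 0" by (simp add: f.diff f_of)
    ultimately show "\<exists>y\<in>UNIV. f y = 0 \<and> x = ?u (augm j) y" by blast
  qed
  obtain E where E: "norm_exact_cover t p n s ?u f E"
    and ker: "{x \<in> E. f x = 0} = ?u (of_nat (p ^ n)) ` {x. f x = 0}"
    using norm_exact_cover_iterate[OF cover, of n] tf p by blast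
  interpret E: norm_exact_cover t p n s ?u f E by fact
  have "\<exists>h. module_hom s ?u h \<and> (\<forall>m. f (h m) = m)"
  proof (rule averaged_section[OF f B assms(3) Q E.subspace_E E.onto])
    show "\<exists>y. x = ?u (of_nat (p ^ n)) y" if "x \<in> E" "f x = 0" for x
      using that ker by blast
    show "x = 0" if "?u (of_nat (p ^ n)) x = 0" for x using tf[OF that Q] .
  qed
  then obtain h where h: "module_hom s ?u h" and fh: "\<And>m. f (h m) = m" by blast
  have "inj h" by (rule inj_on_inverseI) (rule fh)
  then have "isomorphic_to_summand s ?u"
    unfolding isomorphic_to_summand_def using direct_summand_iff_retract[OF h] h f fh by blast
  then show ?thesis by (rule permutation_projectiveI[OF perm])
qed

end
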